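(* Let $\alpha>0$, $T_0>0$, and let $u$ be a smooth solution of the equivariant Skyrme equation \[ \Big(1+\tfrac{\alpha^2\sin^2u}{r^2}\Big)(u_{tt}-u_{rr}) - \Big(1-\tfrac{\alpha^2\sin^2u}{r^2}\Big)\tfrac{u_r}{r} + \tfrac{\sin 2u}{2r^2}\big[\alpha^2(u_t^2-u_r^2)+1\big]=0 \] in $\Omega=\{(t,r):0<t\le T_0,\ 0\le r\le t\}$ (for $r>0$), with $u(t,0)=0$. Then the energy does not concentrate at the origin: \[ \lim_{T\to0^+}\int_0^T\Big[\Big(1+\tfrac{\alpha^2\sin^2u(T,r)}{r^2}\Big)\tfrac{u_t(T,r)^2+u_r(T,r)^2}{2}+\tfrac{\sin^2u(T,r)}{2r^2}\Big]\,r\,dr=0. \]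
   Context: $u=u(t,r)$ is the longitudinal angle of a co-rotational (index 1) equivariant map $U(t,r,\omega)=(u(t,r),\omega)$ from $\mathbb{R}^{2+1}$ to $\mathbb{S}^2$, where $(r,\omega)$ are polar coordinates on $\mathbb{R}^2$; "smooth solution in $\Omega$" means $u$ is smooth on $\Omega$, satisfies the equation for $r>0$, and $u(t,0)=0$. *)

theory Defs
  imports "HOL-Analysis.Analysis"
begin

fun Ck_on :: "nat \<Rightarrow> (real \<times> real \<Rightarrow> real) \<Rightarrow> (real \<times> real) set \<Rightarrow> bool" where
  "Ck_on 0 f U = continuous_on U f"
| "Ck_on (Suc k) f U =
     (\<exists>g h. (\<forall>x\<in>U. (f has_derivative (\<lambda>(a, b). a * g x + b * h x)) (at x))
            \<and> Ck_on k g U \<and> Ck_on k h U)"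

definition smooth_open :: "(real \<times> real \<Rightarrow> real) \<Rightarrow> (real \<times> real) set \<Rightarrow> bool" where
  "smooth_open f U \<longleftrightarrow> open U \<and> (\<forall>k. Ck_on k f U)"

definition smooth_on_set :: "(real \<Rightarrow> real \<Rightarrow> real) \<Rightarrow> (real \<times> real) set \<Rightarrow> bool" where
  "smooth_on_set u S \<longleftrightarrow> (\<exists>U. S \<subseteq> U \<and> smooth_open (\<lambda>(t, r). u t r) U)"

definition dt :: "(real \<Rightarrow> real \<Rightarrow> real) \<Rightarrow> real \<Rightarrow> real \<Rightarrow> real" where
  "dt u t r = deriv (\<lambda>s. u s r) t"

definition dr :: "(real \<Rightarrow> real \<Rightarrow> real) \<Rightarrow> real \<Rightarrow> real \<Rightarrow> real" where
  "dr u t r = deriv (\<lambda>s. u t s) r"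

definition Omega :: "real \<Rightarrow> (real \<times> real) set" where
  "Omega T0 = {(t, r). 0 < t \<and> t \<le> T0 \<and> 0 \<le> r \<and> r \<le> t}"

definition skyrme_eq :: "real \<Rightarrow> (real \<Rightarrow> real \<Rightarrow> real) \<Rightarrow> real \<Rightarrow> real \<Rightarrow> bool" where
  "skyrme_eq \<alpha> u t r \<longleftrightarrow>
     (1 + \<alpha>\<^sup>2 * (sin (u t r))\<^sup>2 / r\<^sup>2) * (dt (dt u) t r - dr (dr u) t r)
     - (1 - \<alpha>\<^sup>2 * (sin (u t r))\<^sup>2 / r\<^sup>2) * dr u t r / r
     + sin (2 * u t r) / (2 * r\<^sup>2) * (\<alpha>\<^sup>2 * ((dt u t r)\<^sup>2 - (dr u t r)\<^sup>2) + 1) = 0"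

definition energy_density :: "real \<Rightarrow> (real \<Rightarrow> real \<Rightarrow> real) \<Rightarrow> real \<Rightarrow> real \<Rightarrow> real" where
  "energy_density \<alpha> u t r =
     (1 + \<alpha>\<^sup>2 * (sin (u t r))\<^sup>2 / r\<^sup>2) * ((dt u t r)\<^sup>2 + (dr u t r)\<^sup>2) / 2
     + (sin (u t r))\<^sup>2 / (2 * r\<^sup>2)"

end

theory Submission
  imports Defs
begin

text \<open>
  Put \<open>k = sin u / r\<close>, \<open>q = \<alpha>\<^sup>2 k\<^sup>2\<close> and let \<open>E t\<close> be the energy in the disc \<open>r \<le> t\<close>. \<open>E\<close> is nondecreasing,
  its derivative being the flux through the cone; let \<open>E0\<close> be its limit at \<open>0\<close>. By Cauchy--Schwarz the Skyrme term
  of the energy controls \<open>1 - cos u \<le> const r\<close> uniformly in time, so that the potential energy in the disc \<open>r \<le> t\<close>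
  is \<open>O(t)\<close> and only the four kinetic terms \<open>u\<^sub>t\<^sup>2\<close>, \<open>u\<^sub>r\<^sup>2\<close>, \<open>q u\<^sub>t\<^sup>2\<close>, \<open>q u\<^sub>r\<^sup>2\<close> matter.

  Fix \<open>S > 0\<close> and put \<open>\<tau> = t + S\<close>. The multiplier \<open>log (\<tau> / (\<tau> - r)) u\<^sub>r\<close> has a coercive bulk term, which bounds
  \<open>\<integral>\<integral> (r / \<tau>) (u\<^sub>t\<^sup>2 + q u\<^sub>r\<^sup>2)\<close> over \<open>S \<le> t \<le> T\<close>; the multiplier \<open>(3 sin u / (1 + q) - sin u) / \<tau>\<close> bounds
  \<open>\<integral>\<integral> (r / \<tau>) (u\<^sub>r\<^sup>2 + q u\<^sub>t\<^sup>2)\<close> in terms of the former. Together they bound \<open>\<integral> E t / \<tau> dt\<close>, which is at least about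
  \<open>E0 log (T / S)\<close>, by \<open>(24 (E T - E0) + O(T)) log (T / S) + O(1)\<close>. Letting first \<open>S\<close> and then \<open>T\<close> tend
  to \<open>0\<close> gives \<open>E0 = 0\<close>.
\<close>

section \<open>Calculus on the cone\<close>

text \<open>The derivative is taken within \<open>A\<close> because rays are later differentiated
  one-sidedly at the ends of \<open>{S..T}\<close>.\<close>

lemma has_real_derivative_along_curve:
  fixes f :: "real \<Rightarrow> real \<Rightarrow> real"
  assumes f: "((\<lambda>(t, r). f t r) has_derivative (\<lambda>(a, b). a * p + b * q)) (at (x t, y t))"
    and x: "(x has_real_derivative x') (at t within A)"
    and y: "(y has_real_derivative y') (at t within A)"
  shows "((\<lambda>s. f (x s) (y s)) has_real_derivative x' * p + y' * q) (at t within A)"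
proof -
  have "((\<lambda>s. (x s, y s)) has_derivative (\<lambda>h. (x' * h, y' * h))) (at t within A)"
    using x y by (auto intro!: has_derivative_Pair simp: has_field_derivative_def)
  from has_derivative_compose[OF this f]
  have "((\<lambda>s. f (x s) (y s)) has_derivative (\<lambda>h. x' * h * p + y' * h * q)) (at t within A)"
    by simp
  then show ?thesis
    unfolding has_field_derivative_def
    by (rule has_derivative_eq_rhs) (auto simp: fun_eq_iff algebra_simps)
qed

text \<open>The second difference of \<open>f\<close> over a small square is the squared side times
  either mixed partial at some point of the square, by two mean value steps in either order;
  continuity carries this to the corner. It serves to identify the r-derivative of \<open>ut\<close>
  with the t-derivative of \<open>ur\<close>, which \<open>Ck_on\<close> delivers as separate
  functions.\<close>

lemma mixed_partials_eq:
  fixes f :: "real \<Rightarrow> real \<Rightarrow> real"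
  assumes U: "open U" "(a, b) \<in> U"
    and fx: "\<And>x y. (x, y) \<in> U \<Longrightarrow> ((\<lambda>x. f x y) has_real_derivative fx x y) (at x)"
    and fy: "\<And>x y. (x, y) \<in> U \<Longrightarrow> ((\<lambda>y. f x y) has_real_derivative fy x y) (at y)"
    and fxy: "\<And>x y. (x, y) \<in> U \<Longrightarrow> ((\<lambda>y. fx x y) has_real_derivative fxy x y) (at y)"
    and fyx: "\<And>x y. (x, y) \<in> U \<Longrightarrow> ((\<lambda>x. fy x y) has_real_derivative fyx x y) (at x)"
    and cxy: "continuous_on U (\<lambda>(x, y). fxy x y)" and cyx: "continuous_on U (\<lambda>(x, y). fyx x y)"
  shows "fxy a b = fyx a b"
proof (rule ccontr)
  assume ne: "fxy a b \<noteq> fyx a b"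
  define e where "e = \<bar>fxy a b - fyx a b\<bar> / 2"
  have e: "e > 0" using ne by (simp add: e_def)
  have "isCont (\<lambda>(x, y). fxy x y) (a, b)" "isCont (\<lambda>(x, y). fyx x y) (a, b)"
    using cxy cyx U by (auto simp: continuous_on_eq_continuous_at)
  then obtain d1 d2 where d1: "d1 > 0" "\<And>x y. dist (x, y) (a, b) < d1 \<Longrightarrow> \<bar>fxy x y - fxy a b\<bar> < e"
    and d2: "d2 > 0" "\<And>x y. dist (x, y) (a, b) < d2 \<Longrightarrow> \<bar>fyx x y - fyx a b\<bar> < e"
    using e by (fastforce simp: continuous_at_eps_delta dist_real_def)
  obtain d3 where d3: "d3 > 0" "ball (a, b) d3 \<subseteq> U"
    using U openE by blast
  \<comment> \<open>Points of the square of side \<open>h\<close> are at distance at most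
    \<open>2 * h\<close> from its corner, hence strictly inside all three radii.\<close>
  define h where "h = min (min d1 d2) d3 / 3"
  have h: "h > 0" using d1 d2 d3 by (simp add: h_def)
  have near: "dist (x, y) (a, b) < 3 * h"
    if "a \<le> x" "x \<le> a + h" "b \<le> y" "y \<le> b + h" for x y
  proof -
    have "dist (x, y) (a, b) \<le> \<bar>x - a\<bar> + \<bar>y - b\<bar>"
      unfolding dist_prod_def by (simp add: dist_real_def sqrt_sum_squares_le_sum_abs)
    then show ?thesis using that h by simp
  qed
  have h3: "3 * h \<le> d1" "3 * h \<le> d2" "3 * h \<le> d3" by (auto simp: h_def)
  have inU: "(x, y) \<in> U" if "a \<le> x" "x \<le> a + h" "b \<le> y" "y \<le> b + h" for x y
    using near[OF that] d3(2) h3 by (auto simp: dist_commute)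
  define D where "D = f (a + h) (b + h) - f (a + h) b - f a (b + h) + f a b"
  have "\<exists>z>a. z < a + h \<and> (f (a + h) (b + h) - f (a + h) b) - (f a (b + h) - f a b)
      = (a + h - a) * (fx z (b + h) - fx z b)"
    using h by (intro MVT2) (auto intro!: derivative_intros fx inU)
  then obtain z where z: "a < z" "z < a + h" "D = h * (fx z (b + h) - fx z b)"
    by (auto simp: D_def algebra_simps)
  have "\<exists>w>b. w < b + h \<and> fx z (b + h) - fx z b = (b + h - b) * fxy z w"
    using h z by (intro MVT2) (auto intro!: derivative_intros fxy inU)
  then obtain w where w: "b < w" "w < b + h" "D = h * (h * fxy z w)"
    using z by auto
  have "\<exists>z>b. z < b + h \<and> (f (a + h) (b + h) - f a (b + h)) - (f (a + h) b - f a b)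
      = (b + h - b) * (fy (a + h) z - fy a z)"
    using h by (intro MVT2) (auto intro!: derivative_intros fy inU)
  then obtain z' where z': "b < z'" "z' < b + h" "D = h * (fy (a + h) z' - fy a z')"
    by (auto simp: D_def algebra_simps)
  have "\<exists>w>a. w < a + h \<and> fy (a + h) z' - fy a z' = (a + h - a) * fyx w z'"
    using h z' by (intro MVT2) (auto intro!: derivative_intros fyx inU)
  then obtain w' where w': "a < w'" "w' < a + h" "D = h * (h * fyx w' z')"
    using z' by auto
  have "fxy z w = fyx w' z'" using w w' h by simp
  moreover have "\<bar>fxy z w - fxy a b\<bar> < e"
    using near[of z w] z w h3 by (intro d1) auto
  moreover have "\<bar>fyx w' z' - fyx a b\<bar> < e"
    using near[of w' z'] z' w' h3 by (intro d2) auto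
  ultimately show False unfolding e_def by (auto simp: field_simps abs_if split: if_splits)
qed

text \<open>Cutting at \<open>S > 0\<close> avoids the tip of the cone, where nothing is known about
  the solution.\<close>

definition trunc_cone :: "real \<Rightarrow> real \<Rightarrow> (real \<times> real) set" where
  "trunc_cone S T = {(t, r). S \<le> t \<and> t \<le> T \<and> 0 \<le> r \<and> r \<le> t}"

lemma integral_scale_interval:
  fixes f :: "real \<Rightarrow> real"
  assumes "0 < t" "continuous_on {0..t} f"
  shows "((\<lambda>y. t * f (t * y)) has_integral integral {0..t} f) {0..1}"
  using has_integral_substitution[of 0 1 "\<lambda>y. t * y" 0 t f "\<lambda>_. t"] assms
  by (auto intro!: derivative_eq_intros simp: mult_left_le)

text \<open>Rescaling \<open>r = t y\<close> turns the moving domain into \<open>0 \<le> y \<le> 1\<close>, so no regularity beyond the cone is needed.\<close>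

lemma cone_integral_has_derivative:
  fixes F G H Ft Fr Gr :: "real \<Rightarrow> real \<Rightarrow> real"
  assumes S: "0 < S" "S \<le> t" "t \<le> T"
    and cF: "continuous_on (trunc_cone S T) (\<lambda>x. F (fst x) (snd x))"
    and cFt: "continuous_on (trunc_cone S T) (\<lambda>x. Ft (fst x) (snd x))"
    and cFr: "continuous_on (trunc_cone S T) (\<lambda>x. Fr (fst x) (snd x))"
    and cG: "continuous_on (trunc_cone S T) (\<lambda>x. G (fst x) (snd x))"
    and cH: "continuous_on (trunc_cone S T) (\<lambda>x. H (fst x) (snd x))"
    and dF: "\<And>t y. \<lbrakk>S \<le> t; t \<le> T; 0 < y; y \<le> 1\<rbrakk> \<Longrightarrow>
      ((\<lambda>s. F s (s * y)) has_real_derivative Ft t (t * y) + y * Fr t (t * y)) (at t within {S..T})"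
    and dFr: "\<And>t r. \<lbrakk>S \<le> t; t \<le> T; 0 < r; r < t\<rbrakk> \<Longrightarrow> (F t has_real_derivative Fr t r) (at r)"
    and dG: "\<And>t r. \<lbrakk>S \<le> t; t \<le> T; 0 < r; r < t\<rbrakk> \<Longrightarrow> (G t has_real_derivative Gr t r) (at r)"
    and law: "\<And>t r. \<lbrakk>S \<le> t; t \<le> T; 0 < r; r < t\<rbrakk> \<Longrightarrow> Ft t r = Gr t r + H t r"
    and F0: "\<And>t. \<lbrakk>S \<le> t; t \<le> T\<rbrakk> \<Longrightarrow> F t 0 = 0"
    and Ft0: "\<And>t. \<lbrakk>S \<le> t; t \<le> T\<rbrakk> \<Longrightarrow> Ft t 0 = 0"
  shows "((\<lambda>t. integral {0..t} (F t)) has_real_derivative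
            F t t + G t t - G t 0 + integral {0..t} (H t)) (at t within {S..T})"
proof -
  have slice: "continuous_on {0..s} (f s)"
    if "continuous_on (trunc_cone S T) (\<lambda>x. f (fst x) (snd x))" "S \<le> s" "s \<le> T"
    for f :: "real \<Rightarrow> real \<Rightarrow> real" and s
    using continuous_on_compose2[OF that(1), of "{0..s}" "\<lambda>r. (s, r)"] that(2,3)
    by (simp add: trunc_cone_def image_subset_iff continuous_on_Pair)
  have scaled: "continuous_on ({S..T} \<times> {0..1}) (\<lambda>x. f (fst x) (fst x * snd x))"
    if "continuous_on (trunc_cone S T) (\<lambda>x. f (fst x) (snd x))" for f :: "real \<Rightarrow> real \<Rightarrow> real"
  proof -
    have "continuous_on ({S..T} \<times> {0..1}) (\<lambda>x. (fst x, fst x * snd x :: real))"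
      by (intro continuous_intros)
    moreover have "(\<lambda>x. (fst x, fst x * snd x)) ` ({S..T} \<times> {0..1}) \<subseteq> trunc_cone S T"
      using S by (auto simp: trunc_cone_def mult_left_le)
    ultimately show ?thesis using continuous_on_compose2[OF that] by fastforce
  qed
  have scaled1: "continuous_on {0..1} (\<lambda>y. f s (s * y))"
    if "continuous_on (trunc_cone S T) (\<lambda>x. f (fst x) (snd x))" "S \<le> s" "s \<le> T"
    for f :: "real \<Rightarrow> real \<Rightarrow> real" and s
  proof -
    have "continuous_on {0..1} (\<lambda>y. (s, s * y))"
      by (intro continuous_intros)
    moreover have "(\<lambda>y. (s, s * y)) ` {0..1} \<subseteq> trunc_cone S T"
      using S that by (auto simp: trunc_cone_def mult_left_le)
    ultimately show ?thesis using continuous_on_compose2[OF that(1)] by fastforce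
  qed
  \<comment> \<open>This is the s-derivative of the rescaled integrand
    \<open>s * F s (s * y)\<close>.\<close>
  define D where "D s y = F s (s * y) + s * (Ft s (s * y) + y * Fr s (s * y))" for s y
  have W: "integral {0..s} (F s) = integral {0..1} (\<lambda>y. s * F s (s * y))" if "S \<le> s" "s \<le> T" for s
    using integral_scale_interval[OF _ slice[OF cF that]] that S by (auto dest: integral_unique)
  have "((\<lambda>s. integral (cbox 0 1) (\<lambda>y. s * F s (s * y))) has_real_derivative
            integral (cbox 0 1) (D t)) (at t within {S..T})"
  proof (rule leibniz_rule_field_derivative)
    fix s y assume s: "s \<in> {S..T}" and y: "y \<in> cbox (0::real) 1"
    show "((\<lambda>s. s * F s (s * y)) has_real_derivative D s y) (at s within {S..T})"
    proof (cases "y = 0")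
      case True
      \<comment> \<open>On the axis \<open>dF\<close> gives nothing; there the integrand vanishes
        for all \<open>s\<close>, and \<open>D s 0 = 0\<close> by \<open>F0\<close> and
        \<open>Ft0\<close>.\<close>
      have "((\<lambda>s. 0) has_real_derivative D s y) (at s within {S..T})"
        using True s F0 Ft0 by (auto simp: D_def)
      then show ?thesis
        by (rule has_field_derivative_transform_within[OF _ zero_less_one]) (use s F0 True in auto)
    next
      case False
      then show ?thesis
        unfolding D_def using s y by (auto intro!: derivative_eq_intros dF)
    qed
  next
    fix s assume "s \<in> {S..T}"
    then show "(\<lambda>y. s * F s (s * y)) integrable_on cbox 0 1"
      by (intro integrable_continuous continuous_intros) (auto intro!: scaled1 cF)
  next
    show "continuous_on ({S..T} \<times> cbox 0 1) (\<lambda>(s, y). D s y)"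
      unfolding D_def split_beta using scaled[OF cF] scaled[OF cFt] scaled[OF cFr]
      by (auto intro!: continuous_intros)
  qed (use S in auto)
  then have "((\<lambda>s. integral {0..s} (F s)) has_real_derivative integral (cbox 0 1) (D t)) (at t within {S..T})"
    by (rule has_field_derivative_transform_within[OF _ zero_less_one]) (use S W in auto)
  moreover have "integral (cbox 0 1) (D t) = F t t + G t t - G t 0 + integral {0..t} (H t)"
  proof -
    \<comment> \<open>By \<open>law\<close> the integrand minus the source is an exact y-derivative,
      that of y F + G. At \<open>y = 1\<close>, F is the contribution of the moving endpoint and G
      the flux through it.\<close>
    have "((\<lambda>y. D t y - t * H t (t * y)) has_integral (1 * F t (t * 1) + G t (t * 1)) - (0 * F t (t * 0) + G t (t * 0))) {0..1}"
    proof (rule fundamental_theorem_of_calculus_interior)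
      show "continuous_on {0..1} (\<lambda>y. y * F t (t * y) + G t (t * y))"
        using scaled1[OF cF] scaled1[OF cG] S by (auto intro!: continuous_intros)
      fix y :: real assume y: "y \<in> {0<..<1}"
      then have r: "0 < t * y" "t * y < t" using S by auto
      have 1: "((\<lambda>y. F t (t * y)) has_real_derivative Fr t (t * y) * t) (at y)"
        by (rule DERIV_chain2[where g = "\<lambda>y. t * y", OF dFr[OF S(2,3) r]])
          (auto intro!: derivative_eq_intros)
      have 2: "((\<lambda>y. G t (t * y)) has_real_derivative Gr t (t * y) * t) (at y)"
        by (rule DERIV_chain2[where g = "\<lambda>y. t * y", OF dG[OF S(2,3) r]])
          (auto intro!: derivative_eq_intros)
      show "((\<lambda>y. y * F t (t * y) + G t (t * y)) has_vector_derivative D t y - t * H t (t * y)) (at y)"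
        unfolding has_real_derivative_iff_has_vector_derivative[symmetric]
        by (rule derivative_eq_intros 1 2 refl)+ (simp add: D_def law[OF S(2,3) r] algebra_simps)
    qed simp
    from has_integral_add[OF this integral_scale_interval[OF _ slice[OF cH S(2,3)]]] S
    show ?thesis by (auto dest: integral_unique)
  qed
  ultimately show ?thesis by simp
qed

section \<open>Elementary inequalities\<close>

lemma nondecreasing_if_derivative_nonneg:
  fixes f :: "real \<Rightarrow> real"
  assumes "a \<le> b"
    and "\<And>x. x \<in> {a..b} \<Longrightarrow> (f has_real_derivative f' x) (at x within {a..b})"
    and "\<And>x. x \<in> {a..b} \<Longrightarrow> 0 \<le> f' x"
  shows "f a \<le> f b"
proof (rule DERIV_nonneg_imp_increasing_open[OF assms(1)])
  show "\<exists>y. (f has_real_derivative y) (at x) \<and> 0 \<le> y" if "a < x" "x < b" for x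
    using assms(2)[of x] assms(3)[of x] that by (auto simp: at_within_Icc_at)
  show "continuous_on {a..b} f"
    using assms(2) by (rule DERIV_continuous_on)
qed

text \<open>The optimal weight is \<open>x / (2 * a)\<close>. This turns a family of weighted
  arithmetic-geometric mean bounds, obtained by integrating a pointwise inequality, into a
  Cauchy-Schwarz inequality.\<close>

lemma square_le_of_le_weighted:
  fixes x a b :: real
  assumes "0 \<le> x" "0 < a" "0 \<le> b" and le: "\<And>\<theta>. 0 < \<theta> \<Longrightarrow> x \<le> \<theta> * a + b / \<theta>"
  shows "x\<^sup>2 \<le> 4 * a * b"
proof (cases "x = 0")
  case True
  then show ?thesis using assms by simp
next
  case False
  then have x: "x > 0" using assms by simp
  then show ?thesis
    using le[of "x / (2 * a)"] assms by (simp add: field_simps power2_eq_square)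
qed

text \<open>The difference of the sides vanishes at 1 and is monotone, since the derivative of 2 ln
  y + 1/y - y is the negative square -(1/y - 1)^2.\<close>

lemma ln_sqrt_bound:
  fixes x :: real
  assumes "0 < x" "x \<le> 1"
  shows "- (2 * ln x) \<le> 1 / x - x"
proof -
  have "2 * ln x + 1 / x - x \<ge> 2 * ln 1 + 1 / 1 - (1::real)"
  proof (rule DERIV_nonpos_imp_nonincreasing[OF assms(2)])
    fix y assume y: "x \<le> y" "y \<le> 1"
    have "((\<lambda>y. 2 * ln y + 1 / y - y) has_real_derivative - (1 / y - 1)\<^sup>2) (at y)"
      using y assms by (auto intro!: derivative_eq_intros simp: field_simps power2_eq_square)
    then show "\<exists>d. ((\<lambda>y. 2 * ln y + 1 / y - y) has_real_derivative d) (at y) \<and> d \<le> 0"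
      by (intro exI[of _ "- (1 / y - 1)\<^sup>2"]) auto
  qed
  then show ?thesis by simp
qed

text \<open>With y = r / \<tau> one has L = -ln(1 - y). The first bound is ln z \<le> z - 1; the
  second is \<open>ln_sqrt_bound\<close> at x = sqrt(1 - y), which gives L x \<le> 1 - x^2 = y. They
  are the two hypotheses of the coercivity estimate below.\<close>

lemma log_multiplier_bounds:
  fixes r \<tau> :: real
  assumes "0 \<le> r" "r < \<tau>"
  defines "L \<equiv> ln \<tau> - ln (\<tau> - r)"
  shows "r / \<tau> \<le> L" "L\<^sup>2 * (1 - r / \<tau>) \<le> (r / \<tau>)\<^sup>2"
proof -
  define y where "y = r / \<tau>"
  have y: "0 \<le> y" "y < 1" using assms by (auto simp: y_def)
  have L: "L = - ln (1 - y)"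
  proof -
    have "1 - y = (\<tau> - r) / \<tau>" using assms by (simp add: y_def field_simps)
    then show ?thesis using assms by (simp add: L_def ln_div)
  qed
  show "r / \<tau> \<le> L" using ln_le_minus_one[of "1 - y"] y by (simp add: L y_def[symmetric])
  define x where "x = sqrt (1 - y)"
  have x: "0 < x" "x \<le> 1" "x\<^sup>2 = 1 - y" using y by (auto simp: x_def)
  have "L = - (2 * ln x)" using y by (simp add: L x_def ln_sqrt)
  then have "L * x \<le> (1 / x - x) * x"
    using ln_sqrt_bound[OF x(1,2)] x by (intro mult_right_mono) auto
  then have "L * x \<le> y" using x by (simp add: algebra_simps power2_eq_square)
  moreover have "0 \<le> L * x" using \<open>r / \<tau> \<le> L\<close> x y by (simp add: y_def)
  ultimately have "(L * x)\<^sup>2 \<le> y\<^sup>2" by (intro power_mono)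
  then show "L\<^sup>2 * (1 - r / \<tau>) \<le> (r / \<tau>)\<^sup>2" by (simp add: power_mult_distrib x y_def[symmetric])
qed

text \<open>With \<open>z = 1 / (1 - y)\<close> and \<open>l = L / y\<close>, the discriminant condition for this quadratic form is
  \<open>z - 1 + l - l\<^sup>2 \<ge> 0\<close>.\<close>

lemma log_multiplier_coercive:
  fixes y L a b :: real
  assumes y: "0 \<le> y" "y < 1" and L: "y \<le> L" "L\<^sup>2 * (1 - y) \<le> y\<^sup>2"
  shows "y * a\<^sup>2 \<le> y / (1 - y) * (a\<^sup>2 + b\<^sup>2 + 2 * y * a * b) + L * (a\<^sup>2 - b\<^sup>2)"
proof (cases "y = 0")
  case True
  then show ?thesis using L by simp
next
  case False
  with y have y: "0 < y" "y < 1" by auto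
  define z l where "z = 1 / (1 - y)" and "l = L / y"
  have z: "z \<ge> 1" "y * z = z - 1" using y by (auto simp: z_def field_simps)
  have l: "1 \<le> l" "l\<^sup>2 \<le> z" using L y by (auto simp: l_def z_def field_simps)
  \<comment> \<open>The coefficient of a^2 once everything is moved to one side and divided by
    \<open>y\<close>; the form is then multiplied by \<open>P\<close> to complete the
    square.\<close>
  define P where "P = z + l - 1"
  have P: "P > 0" using z l by (simp add: P_def)
  have "P * (P * a\<^sup>2 + (z - l) * b\<^sup>2 + 2 * (z - 1) * a * b)
     = (P * a + (z - 1) * b)\<^sup>2 + (z - l\<^sup>2 + (l - 1)) * b\<^sup>2"
    by (simp add: P_def power2_eq_square algebra_simps)
  also have "\<dots> \<ge> 0" using l by (intro add_nonneg_nonneg mult_nonneg_nonneg) auto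
  finally have "0 \<le> P * a\<^sup>2 + (z - l) * b\<^sup>2 + 2 * (z - 1) * a * b"
    using P by (simp add: zero_le_mult_iff)
  then have "0 \<le> y * (P * a\<^sup>2 + (z - l) * b\<^sup>2 + 2 * (z - 1) * a * b)" using y by simp
  also have "\<dots> = y * z * (a\<^sup>2 + b\<^sup>2 + 2 * y * a * b) + L * (a\<^sup>2 - b\<^sup>2) - y * a\<^sup>2"
  proof -
    have "L = y * l" using y by (simp add: l_def)
    then show ?thesis unfolding P_def using z(2) by algebra
  qed
  finally show ?thesis by (simp add: z_def)
qed

text \<open>This estimates \<open>virial\<close>, with c = cos u, a = \<open>ut\<close>, b =
  \<open>ur\<close>. The bracket lies between 2 - 5q and 2 - 2q; the lower bound is used on b^2, the
  upper one on a^2. The good terms b^2 + q a^2 get coefficient -2 and keep -1 because c \<ge> 1/2.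
  The remaining terms are split by the arithmetic-geometric mean inequality.\<close>

lemma virial_pointwise_bound:
  fixes r q k c a b :: real
  assumes "0 \<le> r" "0 \<le> q" "1 / 2 \<le> c" "c \<le> 1"
  shows "r * c * (3 / (1 + q) - 1 - 2 * q) * (a\<^sup>2 - b\<^sup>2)
     - k * (r * k) * c * (2 - q) / (1 + q) - 6 * (r * k) * q * b / (1 + q)
    \<le> r * (2 * a\<^sup>2 + 8 * q * b\<^sup>2 - b\<^sup>2 - q * a\<^sup>2 + 5 * k\<^sup>2)"
proof -
  define \<kappa> where "\<kappa> = 3 / (1 + q) - 1 - 2 * q"
  have \<kappa>: "2 - 5 * q \<le> \<kappa>" "\<kappa> \<le> 2 - 2 * q"
    using assms by (auto simp: \<kappa>_def field_simps)
  have "\<kappa> * (a\<^sup>2 - b\<^sup>2) \<le> (2 * a\<^sup>2 + 5 * q * b\<^sup>2) - 2 * (b\<^sup>2 + q * a\<^sup>2)"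
    using mult_right_mono[OF \<kappa>(1), of "b\<^sup>2"] mult_right_mono[OF \<kappa>(2), of "a\<^sup>2"]
    by (simp add: algebra_simps)
  then have "c * (\<kappa> * (a\<^sup>2 - b\<^sup>2)) \<le> c * (2 * a\<^sup>2 + 5 * q * b\<^sup>2) - c * (2 * (b\<^sup>2 + q * a\<^sup>2))"
    using assms unfolding right_diff_distrib[symmetric] by (intro mult_left_mono) auto
  also have "\<dots> \<le> 1 * (2 * a\<^sup>2 + 5 * q * b\<^sup>2) - 1 / 2 * (2 * (b\<^sup>2 + q * a\<^sup>2))"
    using assms by (intro diff_mono mult_right_mono) auto
  finally have 1: "c * (\<kappa> * (a\<^sup>2 - b\<^sup>2)) \<le> 2 * a\<^sup>2 + 5 * q * b\<^sup>2 - b\<^sup>2 - q * a\<^sup>2"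
    by (simp add: add_divide_distrib)
  have "\<bar>2 - q\<bar> \<le> 2 * (1 + q)" using assms by (simp add: abs_le_iff)
  then have "\<bar>(2 - q) / (1 + q)\<bar> \<le> 2" using assms by (simp add: field_simps)
  then have "\<bar>c * ((2 - q) / (1 + q))\<bar> \<le> 1 * 2"
    unfolding abs_mult using assms by (intro mult_mono) auto
  then have "- (c * ((2 - q) / (1 + q))) \<le> 2" by linarith
  from mult_left_mono[OF this, of "k\<^sup>2"]
  have 2: "- (k * k * c * (2 - q) / (1 + q)) \<le> 2 * k\<^sup>2"
    by (simp add: power2_eq_square mult_ac)
  \<comment> \<open>Both bounds on \<open>w\<close> matter: \<open>w \<le> q\<close> for the part
    with b^2, which must keep the factor \<open>q\<close>, and \<open>w \<le> 1\<close> for the part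
    with k^2.\<close>
  define w where "w = q / (1 + q)"
  have w: "0 \<le> w" "w \<le> 1" "w \<le> q" using assms by (auto simp: w_def field_simps)
  have "0 \<le> w * (k + b)\<^sup>2" using w by simp
  then have "- (2 * k * b * w) \<le> w * b\<^sup>2 + w * k\<^sup>2" by (simp add: power2_eq_square algebra_simps)
  also have "\<dots> \<le> q * b\<^sup>2 + 1 * k\<^sup>2" using w by (intro add_mono mult_right_mono) auto
  finally have "3 * - (2 * k * b * w) \<le> 3 * (q * b\<^sup>2 + k\<^sup>2)" by simp
  moreover have "3 * - (2 * k * b * w) = - (6 * k * q * b / (1 + q))" by (simp add: w_def)
  ultimately have 3: "- (6 * k * q * b / (1 + q)) \<le> 3 * (q * b\<^sup>2 + k\<^sup>2)" by simp
  have "r * (c * (\<kappa> * (a\<^sup>2 - b\<^sup>2)) + - (k * k * c * (2 - q) / (1 + q)) + - (6 * k * q * b / (1 + q)))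
    \<le> r * ((2 * a\<^sup>2 + 5 * q * b\<^sup>2 - b\<^sup>2 - q * a\<^sup>2) + 2 * k\<^sup>2 + 3 * (q * b\<^sup>2 + k\<^sup>2))"
    using assms by (intro mult_left_mono add_mono 1 2 3)
  moreover have "r * (c * (\<kappa> * (a\<^sup>2 - b\<^sup>2)) + - (k * k * c * (2 - q) / (1 + q)) + - (6 * k * q * b / (1 + q)))
    = r * c * (3 / (1 + q) - 1 - 2 * q) * (a\<^sup>2 - b\<^sup>2)
     - k * (r * k) * c * (2 - q) / (1 + q) - 6 * (r * k) * q * b / (1 + q)"
    unfolding \<kappa>_def[symmetric] by (simp add: algebra_simps)
  ultimately show ?thesis by (simp add: algebra_simps)
qed

text \<open>For the part without \<open>q\<close>, |s| / \<tau> \<le> |k| suffices. With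
  \<open>q\<close> this would produce q k^2, which is quartic in \<open>k\<close> and not part of
  the energy density; the bound on q s^2 is used instead and leaves the term with
  \<open>Y\<close>.\<close>

lemma virial_boundary_pointwise:
  fixes r q k s a \<tau> Y :: real
  assumes r: "0 \<le> r" "r \<le> \<tau>" "0 < \<tau>" and q: "0 \<le> q" "q * s\<^sup>2 \<le> 2 * Y" and s: "s = r * k"
  shows "\<bar>r * s * (2 - q) * a\<bar> / \<tau> \<le> r * (a\<^sup>2 + k\<^sup>2 + q * a\<^sup>2 / 2) + r * (Y / \<tau>\<^sup>2)"
proof -
  have y: "\<bar>s\<bar> / \<tau> \<le> \<bar>k\<bar>"
    using r by (simp add: s abs_mult field_simps mult_right_mono)
  have "2 * (\<bar>s\<bar> / \<tau>) * \<bar>a\<bar> \<le> 2 * \<bar>k\<bar> * \<bar>a\<bar>" using y by (intro mult_right_mono) auto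
  also have "\<dots> \<le> a\<^sup>2 + k\<^sup>2" using zero_le_power2[of "\<bar>k\<bar> - \<bar>a\<bar>"] by (simp add: power2_diff)
  finally have 1: "2 * (\<bar>s\<bar> / \<tau>) * \<bar>a\<bar> \<le> a\<^sup>2 + k\<^sup>2" .
  have "(\<bar>s\<bar> / \<tau>) * \<bar>a\<bar> \<le> (a\<^sup>2 + (s / \<tau>)\<^sup>2) / 2"
    using zero_le_power2[of "\<bar>s\<bar> / \<tau> - \<bar>a\<bar>"] by (simp add: power2_diff power_divide mult_ac)
  then have "q * ((\<bar>s\<bar> / \<tau>) * \<bar>a\<bar>) \<le> q * ((a\<^sup>2 + (s / \<tau>)\<^sup>2) / 2)"
    using q by (intro mult_left_mono)
  also have "\<dots> = q * a\<^sup>2 / 2 + q * s\<^sup>2 / (2 * \<tau>\<^sup>2)"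
    by (simp add: field_simps power_divide)
  also have "\<dots> \<le> q * a\<^sup>2 / 2 + 2 * Y / (2 * \<tau>\<^sup>2)"
    using q r by (intro add_left_mono divide_right_mono) auto
  finally have 2: "q * (\<bar>s\<bar> / \<tau>) * \<bar>a\<bar> \<le> q * a\<^sup>2 / 2 + Y / \<tau>\<^sup>2" by simp
  have "\<bar>r * s * (2 - q) * a\<bar> / \<tau> = r * (\<bar>2 - q\<bar> * (\<bar>s\<bar> / \<tau>) * \<bar>a\<bar>)"
    using r by (simp add: abs_mult)
  also have "\<dots> \<le> r * ((2 + q) * (\<bar>s\<bar> / \<tau>) * \<bar>a\<bar>)"
    using r q by (intro mult_left_mono mult_right_mono) auto
  also have "\<dots> = r * (2 * (\<bar>s\<bar> / \<tau>) * \<bar>a\<bar> + q * (\<bar>s\<bar> / \<tau>) * \<bar>a\<bar>)"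
    by (simp add: algebra_simps add_divide_distrib)
  also have "\<dots> \<le> r * ((a\<^sup>2 + k\<^sup>2) + (q * a\<^sup>2 / 2 + Y / \<tau>\<^sup>2))"
    using r by (intro mult_left_mono add_mono 1 2)
  finally show ?thesis by (simp add: algebra_simps)
qed

lemma sin_sq_le: "(sin x)\<^sup>2 \<le> 2 * (1 - cos x)" for x :: real
  using zero_le_power2[of "1 - cos x"] by (simp add: power2_diff sin_squared_eq)

lemma trunc_cone_subset: "0 < S \<Longrightarrow> T \<le> T0 \<Longrightarrow> trunc_cone S T \<subseteq> Omega T0"
  by (auto simp: trunc_cone_def Omega_def)

section \<open>Multiplier identities\<close>

text \<open>\<open>k\<close> extends \<open>sin u / r\<close> continuously to the axis \<open>r = 0\<close>, where the quotient itself would be \<open>0\<close>.\<close>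

locale skyrme_cone =
  fixes \<alpha> T0 :: real and u ut ur utt utr urr k :: "real \<Rightarrow> real \<Rightarrow> real"
  assumes \<alpha>: "\<alpha> > 0" and T0: "T0 > 0"
    and cont [continuous_intros]:
      "continuous_on (Omega T0) (\<lambda>x. u (fst x) (snd x))"
      "continuous_on (Omega T0) (\<lambda>x. ut (fst x) (snd x))"
      "continuous_on (Omega T0) (\<lambda>x. ur (fst x) (snd x))"
      "continuous_on (Omega T0) (\<lambda>x. utt (fst x) (snd x))"
      "continuous_on (Omega T0) (\<lambda>x. utr (fst x) (snd x))"
      "continuous_on (Omega T0) (\<lambda>x. urr (fst x) (snd x))"
      "continuous_on (Omega T0) (\<lambda>x. k (fst x) (snd x))"
    and du: "\<And>t r. (t, r) \<in> Omega T0 \<Longrightarrow>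
      ((\<lambda>(t, r). u t r) has_derivative (\<lambda>(a, b). a * ut t r + b * ur t r)) (at (t, r))"
    and dut: "\<And>t r. (t, r) \<in> Omega T0 \<Longrightarrow>
      ((\<lambda>(t, r). ut t r) has_derivative (\<lambda>(a, b). a * utt t r + b * utr t r)) (at (t, r))"
    and dur: "\<And>t r. (t, r) \<in> Omega T0 \<Longrightarrow>
      ((\<lambda>(t, r). ur t r) has_derivative (\<lambda>(a, b). a * utr t r + b * urr t r)) (at (t, r))"
    and rk: "\<And>t r. (t, r) \<in> Omega T0 \<Longrightarrow> r * k t r = sin (u t r)"
    and u0: "\<And>t. 0 < t \<Longrightarrow> t \<le> T0 \<Longrightarrow> u t 0 = 0"
    and ut0: "\<And>t. 0 < t \<Longrightarrow> t \<le> T0 \<Longrightarrow> ut t 0 = 0"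
    and skyrme: "\<And>t r. (t, r) \<in> Omega T0 \<Longrightarrow> 0 < r \<Longrightarrow>
      r * (1 + \<alpha>\<^sup>2 * (k t r)\<^sup>2) * (utt t r - urr t r) - (1 - \<alpha>\<^sup>2 * (k t r)\<^sup>2) * ur t r
        + k t r * cos (u t r) * (\<alpha>\<^sup>2 * ((ut t r)\<^sup>2 - (ur t r)\<^sup>2) + 1) = 0"
begin

definition edens :: "real \<Rightarrow> real \<Rightarrow> real" where
  "edens t r = r * ((1 + \<alpha>\<^sup>2 * (k t r)\<^sup>2) * ((ut t r)\<^sup>2 + (ur t r)\<^sup>2) + (k t r)\<^sup>2) / 2"

text \<open>It plays two roles: the flux in the energy law and the density in the momentum law,
  where it arises from the multiplier \<open>ur\<close>.\<close>

definition mdens :: "real \<Rightarrow> real \<Rightarrow> real" where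
  "mdens t r = r * (1 + \<alpha>\<^sup>2 * (k t r)\<^sup>2) * ut t r * ur t r"

definition mflux :: "real \<Rightarrow> real \<Rightarrow> real" where
  "mflux t r = r * ((1 + \<alpha>\<^sup>2 * (k t r)\<^sup>2) * ((ut t r)\<^sup>2 + (ur t r)\<^sup>2) - (k t r)\<^sup>2) / 2"

text \<open>For the multiplier \<open>g = 3 sin u / (1 + q) - sin u\<close> one has \<open>(1 + q) g = sin u (2 - q)\<close>, so the density \<open>r (1 + q) u\<^sub>t g\<close>
  needs no division.\<close>

definition vdens :: "real \<Rightarrow> real \<Rightarrow> real" where
  "vdens t r = r * sin (u t r) * (2 - \<alpha>\<^sup>2 * (k t r)\<^sup>2) * ut t r"

definition vflux :: "real \<Rightarrow> real \<Rightarrow> real" where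
  "vflux t r = r * sin (u t r) * (2 - \<alpha>\<^sup>2 * (k t r)\<^sup>2) * ur t r"

text \<open>The partial derivatives are written with \<open>r k\<^sub>t = cos u u\<^sub>t\<close> and \<open>r k\<^sub>r = cos u u\<^sub>r - k\<close> eliminated, which makes
  them continuous up to \<open>r = 0\<close>.\<close>

definition edens_t :: "real \<Rightarrow> real \<Rightarrow> real" where
  "edens_t t r = \<alpha>\<^sup>2 * k t r * (cos (u t r) * ut t r) * ((ut t r)\<^sup>2 + (ur t r)\<^sup>2)
     + r * (1 + \<alpha>\<^sup>2 * (k t r)\<^sup>2) * (ut t r * utt t r + ur t r * utr t r)
     + k t r * (cos (u t r) * ut t r)"

definition edens_r :: "real \<Rightarrow> real \<Rightarrow> real" where
  "edens_r t r = ((1 + \<alpha>\<^sup>2 * (k t r)\<^sup>2) * ((ut t r)\<^sup>2 + (ur t r)\<^sup>2) + (k t r)\<^sup>2) / 2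
     + \<alpha>\<^sup>2 * k t r * (cos (u t r) * ur t r - k t r) * ((ut t r)\<^sup>2 + (ur t r)\<^sup>2)
     + r * (1 + \<alpha>\<^sup>2 * (k t r)\<^sup>2) * (ut t r * utr t r + ur t r * urr t r) + k t r * (cos (u t r) * ur t r - k t r)"

definition mdens_t :: "real \<Rightarrow> real \<Rightarrow> real" where
  "mdens_t t r = 2 * \<alpha>\<^sup>2 * k t r * (cos (u t r) * ut t r) * ut t r * ur t r
     + r * (1 + \<alpha>\<^sup>2 * (k t r)\<^sup>2) * (utt t r * ur t r + ut t r * utr t r)"

definition mdens_r :: "real \<Rightarrow> real \<Rightarrow> real" where
  "mdens_r t r = (1 + \<alpha>\<^sup>2 * (k t r)\<^sup>2) * ut t r * ur t r
     + 2 * \<alpha>\<^sup>2 * k t r * (cos (u t r) * ur t r - k t r) * ut t r * ur t r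
     + r * (1 + \<alpha>\<^sup>2 * (k t r)\<^sup>2) * (utr t r * ur t r + ut t r * urr t r)"

definition mflux_r :: "real \<Rightarrow> real \<Rightarrow> real" where
  "mflux_r t r = ((1 + \<alpha>\<^sup>2 * (k t r)\<^sup>2) * ((ut t r)\<^sup>2 + (ur t r)\<^sup>2) - (k t r)\<^sup>2) / 2
     + \<alpha>\<^sup>2 * k t r * (cos (u t r) * ur t r - k t r) * ((ut t r)\<^sup>2 + (ur t r)\<^sup>2)
     + r * (1 + \<alpha>\<^sup>2 * (k t r)\<^sup>2) * (ut t r * utr t r + ur t r * urr t r) - k t r * (cos (u t r) * ur t r - k t r)"

definition vdens_t :: "real \<Rightarrow> real \<Rightarrow> real" where
  "vdens_t t r = r * cos (u t r) * (ut t r)\<^sup>2 * (2 - \<alpha>\<^sup>2 * (k t r)\<^sup>2)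
     - 2 * \<alpha>\<^sup>2 * sin (u t r) * k t r * (cos (u t r) * ut t r) * ut t r
     + r * sin (u t r) * (2 - \<alpha>\<^sup>2 * (k t r)\<^sup>2) * utt t r"

definition vdens_r :: "real \<Rightarrow> real \<Rightarrow> real" where
  "vdens_r t r = sin (u t r) * (2 - \<alpha>\<^sup>2 * (k t r)\<^sup>2) * ut t r
     + r * cos (u t r) * ur t r * (2 - \<alpha>\<^sup>2 * (k t r)\<^sup>2) * ut t r
     - 2 * \<alpha>\<^sup>2 * sin (u t r) * k t r * (cos (u t r) * ur t r - k t r) * ut t r
     + r * sin (u t r) * (2 - \<alpha>\<^sup>2 * (k t r)\<^sup>2) * utr t r"

definition vflux_r :: "real \<Rightarrow> real \<Rightarrow> real" where
  "vflux_r t r = sin (u t r) * (2 - \<alpha>\<^sup>2 * (k t r)\<^sup>2) * ur t r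
     + r * cos (u t r) * (ur t r)\<^sup>2 * (2 - \<alpha>\<^sup>2 * (k t r)\<^sup>2)
     - 2 * \<alpha>\<^sup>2 * sin (u t r) * k t r * (cos (u t r) * ur t r - k t r) * ur t r
     + r * sin (u t r) * (2 - \<alpha>\<^sup>2 * (k t r)\<^sup>2) * urr t r"

section \<open>Continuity of the densities up to the axis, and their derivatives along radii and
  rays\<close>

lemma cont_edens [continuous_intros]: "continuous_on (Omega T0) (\<lambda>x. edens (fst x) (snd x))"
  unfolding edens_def by (intro continuous_intros) auto

lemma cont_mdens [continuous_intros]: "continuous_on (Omega T0) (\<lambda>x. mdens (fst x) (snd x))"
  unfolding mdens_def by (intro continuous_intros)

lemma cont_mflux [continuous_intros]: "continuous_on (Omega T0) (\<lambda>x. mflux (fst x) (snd x))"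
  unfolding mflux_def by (intro continuous_intros) auto

lemma cont_vdens [continuous_intros]: "continuous_on (Omega T0) (\<lambda>x. vdens (fst x) (snd x))"
  unfolding vdens_def by (intro continuous_intros)

lemma cont_vflux [continuous_intros]: "continuous_on (Omega T0) (\<lambda>x. vflux (fst x) (snd x))"
  unfolding vflux_def by (intro continuous_intros)

lemma cont_edens_t [continuous_intros]: "continuous_on (Omega T0) (\<lambda>x. edens_t (fst x) (snd x))"
  unfolding edens_t_def by (intro continuous_intros)

lemma cont_edens_r [continuous_intros]: "continuous_on (Omega T0) (\<lambda>x. edens_r (fst x) (snd x))"
  unfolding edens_r_def by (intro continuous_intros) auto

lemma cont_mdens_t [continuous_intros]: "continuous_on (Omega T0) (\<lambda>x. mdens_t (fst x) (snd x))"
  unfolding mdens_t_def by (intro continuous_intros)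

lemma cont_mdens_r [continuous_intros]: "continuous_on (Omega T0) (\<lambda>x. mdens_r (fst x) (snd x))"
  unfolding mdens_r_def by (intro continuous_intros)

lemma cont_vdens_t [continuous_intros]: "continuous_on (Omega T0) (\<lambda>x. vdens_t (fst x) (snd x))"
  unfolding vdens_t_def by (intro continuous_intros)

lemma cont_vdens_r [continuous_intros]: "continuous_on (Omega T0) (\<lambda>x. vdens_r (fst x) (snd x))"
  unfolding vdens_r_def by (intro continuous_intros)

lemma radial_derivatives:
  assumes "(t, r) \<in> Omega T0"
  shows u_radial: "(u t has_real_derivative ur t r) (at r)"
    and ut_radial: "(ut t has_real_derivative utr t r) (at r)"
    and ur_radial: "(ur t has_real_derivative urr t r) (at r)"
proof -
  note * = has_real_derivative_along_curve[where x = "\<lambda>_. t" and y = "\<lambda>r. r" and x' = 0 and y' = 1 and t = r]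
  show "(u t has_real_derivative ur t r) (at r)"
    "(ut t has_real_derivative utr t r) (at r)"
    "(ur t has_real_derivative urr t r) (at r)"
    using *[OF du[OF assms]] *[OF dut[OF assms]] *[OF dur[OF assms]] by simp_all
qed

text \<open>Differentiability of \<open>k\<close> comes from that of sin u / r, with which it agrees
  near every point with 0 < r < t; the strict bounds keep this neighbourhood inside
  \<open>Omega T0\<close>.\<close>

lemma k_radial:
  assumes "(t, r) \<in> Omega T0" "0 < r" "r < t"
  shows "(k t has_real_derivative (cos (u t r) * ur t r - k t r) / r) (at r)"
proof -
  have "((\<lambda>r. sin (u t r) / r) has_real_derivative (cos (u t r) * ur t r - k t r) / r) (at r)"
    using assms rk[OF assms(1), symmetric]
    by (auto intro!: derivative_eq_intros u_radial simp: field_simps)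
  then show ?thesis
  proof (rule has_field_derivative_transform_within_open)
    fix s assume "s \<in> {0<..<t}"
    then show "sin (u t s) / s = k t s"
      using assms rk[of t s, symmetric] by (auto simp: Omega_def)
  qed (use assms in auto)
qed

text \<open>These feed the hypothesis \<open>dF\<close> of the differentiation rule. A ray with y
  \<le> 1 never leaves the cone, so \<open>k\<close> can be replaced by sin u / r along it even on
  the boundary y = 1.\<close>

lemma ray_derivatives:
  assumes "0 < S" "S \<le> t" "t \<le> T" "T \<le> T0" "0 < y" "y \<le> 1"
  shows u_ray: "((\<lambda>s. u s (s * y)) has_real_derivative ut t (t * y) + y * ur t (t * y)) (at t within {S..T})"
    and ut_ray: "((\<lambda>s. ut s (s * y)) has_real_derivative utt t (t * y) + y * utr t (t * y)) (at t within {S..T})"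
    and ur_ray: "((\<lambda>s. ur s (s * y)) has_real_derivative utr t (t * y) + y * urr t (t * y)) (at t within {S..T})"
    and k_ray: "((\<lambda>s. k s (s * y)) has_real_derivative
      cos (u t (t * y)) * ut t (t * y) / (t * y) + y * ((cos (u t (t * y)) * ur t (t * y) - k t (t * y)) / (t * y))) (at t within {S..T})"
proof -
  have O: "(s, s * y) \<in> Omega T0" if "s \<in> {S..T}" for s
    using that assms by (auto simp: Omega_def mult_left_le)
  have tO: "(t, t * y) \<in> Omega T0" using assms by (intro O) auto
  note * = has_real_derivative_along_curve[where x = "\<lambda>s. s" and y = "\<lambda>s. s * y" and x' = 1 and y' = y and t = t]
  have ty: "((\<lambda>s. s * y) has_real_derivative y) (at t within {S..T})"
    by (auto intro!: derivative_eq_intros)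
  show 1: "((\<lambda>s. u s (s * y)) has_real_derivative ut t (t * y) + y * ur t (t * y)) (at t within {S..T})"
    and "((\<lambda>s. ut s (s * y)) has_real_derivative utt t (t * y) + y * utr t (t * y)) (at t within {S..T})"
    and "((\<lambda>s. ur s (s * y)) has_real_derivative utr t (t * y) + y * urr t (t * y)) (at t within {S..T})"
    using *[OF du[OF tO] _ ty] *[OF dut[OF tO] _ ty] *[OF dur[OF tO] _ ty] by simp_all
  have "((\<lambda>s. sin (u s (s * y)) / (s * y)) has_real_derivative
      (cos (u t (t * y)) * (ut t (t * y) + y * ur t (t * y)) * (t * y) - sin (u t (t * y)) * y)
        / ((t * y) * (t * y))) (at t within {S..T})"
    using assms by (intro DERIV_divide DERIV_chain2[OF DERIV_sin 1] ty) auto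
  also have "(cos (u t (t * y)) * (ut t (t * y) + y * ur t (t * y)) * (t * y) - sin (u t (t * y)) * y)
        / ((t * y) * (t * y)) =
      cos (u t (t * y)) * ut t (t * y) / (t * y) + y * ((cos (u t (t * y)) * ur t (t * y) - k t (t * y)) / (t * y))"
    using assms by (simp add: rk[OF tO, symmetric] field_simps)
  finally have "((\<lambda>s. sin (u s (s * y)) / (s * y)) has_real_derivative
      cos (u t (t * y)) * ut t (t * y) / (t * y) + y * ((cos (u t (t * y)) * ur t (t * y) - k t (t * y)) / (t * y)))
      (at t within {S..T})" .
  then show "((\<lambda>s. k s (s * y)) has_real_derivative
      cos (u t (t * y)) * ut t (t * y) / (t * y) + y * ((cos (u t (t * y)) * ur t (t * y) - k t (t * y)) / (t * y))) (at t within {S..T})"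
  proof (rule has_field_derivative_transform_within[OF _ zero_less_one])
    fix s assume "s \<in> {S..T}"
    then show "sin (u s (s * y)) / (s * y) = k s (s * y)"
      using rk[OF O, of s, symmetric] assms by auto
  qed (use assms in auto)
qed

lemma edens_radial:
  assumes "(t, r) \<in> Omega T0" "0 < r" "r < t"
  shows "(edens t has_real_derivative edens_r t r) (at r)"
proof -
  \<comment> \<open>\<open>d\<close> is the r-derivative of \<open>k\<close>. Naming it lets the
    eliminated expression be written back as r times that derivative; in the lemmas on rays
    \<open>e\<close> is likewise the t-derivative.\<close>
  define d where "d = (cos (u t r) * ur t r - k t r) / r"
  have d: "cos (u t r) * ur t r - k t r = r * d" using assms by (simp add: d_def)
  show ?thesis
    unfolding edens_def edens_r_def d
    by (rule derivative_eq_intros radial_derivatives[OF assms(1)] k_radial[OF assms, folded d_def] refl)+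
      (simp_all add: field_simps power2_eq_square)
qed

lemma mdens_radial:
  assumes "(t, r) \<in> Omega T0" "0 < r" "r < t"
  shows "(mdens t has_real_derivative mdens_r t r) (at r)"
proof -
  define d where "d = (cos (u t r) * ur t r - k t r) / r"
  have d: "cos (u t r) * ur t r - k t r = r * d" using assms by (simp add: d_def)
  show ?thesis
    unfolding mdens_def mdens_r_def d
    by (rule derivative_eq_intros radial_derivatives[OF assms(1)] k_radial[OF assms, folded d_def] refl)+
      (simp_all add: field_simps power2_eq_square)
qed

lemma mflux_radial:
  assumes "(t, r) \<in> Omega T0" "0 < r" "r < t"
  shows "(mflux t has_real_derivative mflux_r t r) (at r)"
proof -
  define d where "d = (cos (u t r) * ur t r - k t r) / r"
  have d: "cos (u t r) * ur t r - k t r = r * d" using assms by (simp add: d_def)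
  show ?thesis
    unfolding mflux_def mflux_r_def d
    by (rule derivative_eq_intros radial_derivatives[OF assms(1)] k_radial[OF assms, folded d_def] refl)+
      (simp_all add: field_simps power2_eq_square)
qed

lemma vdens_radial:
  assumes "(t, r) \<in> Omega T0" "0 < r" "r < t"
  shows "(vdens t has_real_derivative vdens_r t r) (at r)"
proof -
  define d where "d = (cos (u t r) * ur t r - k t r) / r"
  have d: "cos (u t r) * ur t r - k t r = r * d" using assms by (simp add: d_def)
  show ?thesis
    unfolding vdens_def vdens_r_def d
    by (rule derivative_eq_intros radial_derivatives[OF assms(1)] k_radial[OF assms, folded d_def] refl)+
      (simp_all add: field_simps power2_eq_square)
qed

lemma vflux_radial:
  assumes "(t, r) \<in> Omega T0" "0 < r" "r < t"
  shows "(vflux t has_real_derivative vflux_r t r) (at r)"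
proof -
  define d where "d = (cos (u t r) * ur t r - k t r) / r"
  have d: "cos (u t r) * ur t r - k t r = r * d" using assms by (simp add: d_def)
  show ?thesis
    unfolding vflux_def vflux_r_def d
    by (rule derivative_eq_intros radial_derivatives[OF assms(1)] k_radial[OF assms, folded d_def] refl)+
      (simp_all add: field_simps power2_eq_square)
qed

lemma edens_ray:
  assumes "0 < S" "S \<le> t" "t \<le> T" "T \<le> T0" "0 < y" "y \<le> 1"
  shows "((\<lambda>s. edens s (s * y)) has_real_derivative edens_t t (t * y) + y * edens_r t (t * y)) (at t within {S..T})"
proof -
  define d where "d = (cos (u t (t * y)) * ur t (t * y) - k t (t * y)) / (t * y)"
  define e where "e = cos (u t (t * y)) * ut t (t * y) / (t * y)"
  have d: "cos (u t (t * y)) * ur t (t * y) - k t (t * y) = t * y * d"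
    and e: "cos (u t (t * y)) * ut t (t * y) = t * y * e"
    using assms by (simp_all add: d_def e_def)
  show ?thesis
    unfolding edens_def edens_r_def edens_t_def d e
    by (rule derivative_eq_intros ray_derivatives[OF assms, folded d_def e_def] refl)+
      (simp_all add: field_simps power2_eq_square)
qed

lemma mdens_ray:
  assumes "0 < S" "S \<le> t" "t \<le> T" "T \<le> T0" "0 < y" "y \<le> 1"
  shows "((\<lambda>s. mdens s (s * y)) has_real_derivative mdens_t t (t * y) + y * mdens_r t (t * y)) (at t within {S..T})"
proof -
  define d where "d = (cos (u t (t * y)) * ur t (t * y) - k t (t * y)) / (t * y)"
  define e where "e = cos (u t (t * y)) * ut t (t * y) / (t * y)"
  have d: "cos (u t (t * y)) * ur t (t * y) - k t (t * y) = t * y * d"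
    and e: "cos (u t (t * y)) * ut t (t * y) = t * y * e"
    using assms by (simp_all add: d_def e_def)
  show ?thesis
    unfolding mdens_def mdens_r_def mdens_t_def d e
    by (rule derivative_eq_intros ray_derivatives[OF assms, folded d_def e_def] refl)+
      (simp_all add: field_simps power2_eq_square)
qed

lemma vdens_ray:
  assumes "0 < S" "S \<le> t" "t \<le> T" "T \<le> T0" "0 < y" "y \<le> 1"
  shows "((\<lambda>s. vdens s (s * y)) has_real_derivative vdens_t t (t * y) + y * vdens_r t (t * y)) (at t within {S..T})"
proof -
  define d where "d = (cos (u t (t * y)) * ur t (t * y) - k t (t * y)) / (t * y)"
  define e where "e = cos (u t (t * y)) * ut t (t * y) / (t * y)"
  have d: "cos (u t (t * y)) * ur t (t * y) - k t (t * y) = t * y * d"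
    and e: "cos (u t (t * y)) * ut t (t * y) = t * y * e"
    using assms by (simp_all add: d_def e_def)
  show ?thesis
    unfolding vdens_def vdens_r_def vdens_t_def d e
    by (rule derivative_eq_intros ray_derivatives[OF assms, folded d_def e_def] refl)+
      (simp_all add: field_simps power2_eq_square)
qed

section \<open>Local conservation laws and their sources\<close>

lemma energy_law:
  assumes "(t, r) \<in> Omega T0" "0 < r"
  shows "edens_t t r = mdens_r t r"
  unfolding edens_t_def mdens_r_def using skyrme[OF assms] by algebra

text \<open>The two sides differ by \<open>ur\<close> times the equation; in
  \<open>energy_law\<close> the factor is \<open>ut\<close>, and in \<open>virial_law\<close> it is
  sin u (2 - q) / (1 + q).\<close>

lemma momentum_law:
  assumes "(t, r) \<in> Omega T0" "0 < r"
  shows "mdens_t t r = mflux_r t r - ((1 - \<alpha>\<^sup>2 * (k t r)\<^sup>2) * ((ut t r)\<^sup>2 - (ur t r)\<^sup>2) + (k t r)\<^sup>2) / 2"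
proof -
  have "2 * mdens_t t r = 2 * mflux_r t r - ((1 - \<alpha>\<^sup>2 * (k t r)\<^sup>2) * ((ut t r)\<^sup>2 - (ur t r)\<^sup>2) + (k t r)\<^sup>2)"
    unfolding mdens_t_def mflux_r_def using skyrme[OF assms] by (simp add: field_simps) algebra
  moreover have "m = f - x / 2" if "2 * m = 2 * f - x" for m f x :: real using that by simp
  ultimately show ?thesis by blast
qed

text \<open>The source left by the virial multiplier. Its bracket equals (1 - 2q)(2 + q) / (1 + q).
  Where \<open>q\<close> is small it is positive and \<open>ur\<close> is controlled by
  \<open>ut\<close>; where \<open>q\<close> is large it is negative, of size 2q, and the roles are
  exchanged. This sign change is what the combination of two terms in the multiplier is made
  for.\<close>

definition virial :: "real \<Rightarrow> real \<Rightarrow> real" where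
  "virial t r = r * cos (u t r) * (3 / (1 + \<alpha>\<^sup>2 * (k t r)\<^sup>2) - 1 - 2 * \<alpha>\<^sup>2 * (k t r)\<^sup>2) * ((ut t r)\<^sup>2 - (ur t r)\<^sup>2)
     - k t r * sin (u t r) * cos (u t r) * (2 - \<alpha>\<^sup>2 * (k t r)\<^sup>2) / (1 + \<alpha>\<^sup>2 * (k t r)\<^sup>2)
     - 6 * sin (u t r) * \<alpha>\<^sup>2 * (k t r)\<^sup>2 * ur t r / (1 + \<alpha>\<^sup>2 * (k t r)\<^sup>2)"

lemma virial_law:
  assumes "(t, r) \<in> Omega T0" "0 < r"
  shows "vdens_t t r = vflux_r t r + virial t r"
proof -
  define A where "A = 1 + \<alpha>\<^sup>2 * (k t r)\<^sup>2"
  have A: "A > 0" unfolding A_def by (simp add: add_pos_nonneg)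
  \<comment> \<open>Replacing the division by the relation w (1 + q) = 1 makes the claim a
    polynomial consequence of the equation and of r k = sin u.\<close>
  define w where "w = 1 / A"
  have w: "w * (1 + \<alpha>\<^sup>2 * (k t r)\<^sup>2) = 1" using A by (simp add: w_def A_def)
  have "virial t r = r * cos (u t r) * (3 * w - 1 - 2 * \<alpha>\<^sup>2 * (k t r)\<^sup>2) * ((ut t r)\<^sup>2 - (ur t r)\<^sup>2)
     - k t r * sin (u t r) * cos (u t r) * (2 - \<alpha>\<^sup>2 * (k t r)\<^sup>2) * w
     - 6 * sin (u t r) * \<alpha>\<^sup>2 * (k t r)\<^sup>2 * ur t r * w"
    unfolding virial_def w_def A_def by simp
  then show ?thesis
    unfolding vdens_t_def vflux_r_def using skyrme[OF assms] w rk[OF assms(1)] by algebra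
qed

section \<open>Energy and pointwise decay\<close>

lemma slice_continuous:
  fixes f :: "real \<Rightarrow> real \<Rightarrow> real"
  assumes "continuous_on (Omega T0) (\<lambda>x. f (fst x) (snd x))" "0 < t" "t \<le> T0"
  shows "continuous_on {0..t} (f t)"
  using continuous_on_compose2[OF assms(1), of "{0..t}" "\<lambda>r. (t, r)"] assms(2,3)
  by (simp add: Omega_def image_subset_iff continuous_on_Pair)

definition E :: "real \<Rightarrow> real" where "E t = integral {0..t} (edens t)"
definition kin_t :: "real \<Rightarrow> real" where "kin_t t = integral {0..t} (\<lambda>r. r * (ut t r)\<^sup>2)"
definition kin_r :: "real \<Rightarrow> real" where "kin_r t = integral {0..t} (\<lambda>r. r * (ur t r)\<^sup>2)"
definition skyrme_t :: "real \<Rightarrow> real" where "skyrme_t t = integral {0..t} (\<lambda>r. r * (\<alpha>\<^sup>2 * (k t r)\<^sup>2 * (ut t r)\<^sup>2))"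
definition skyrme_r :: "real \<Rightarrow> real" where "skyrme_r t = integral {0..t} (\<lambda>r. r * (\<alpha>\<^sup>2 * (k t r)\<^sup>2 * (ur t r)\<^sup>2))"
definition pot :: "real \<Rightarrow> real" where "pot t = integral {0..t} (\<lambda>r. r * (k t r)\<^sup>2)"

lemma slice_integrable:
  fixes f :: "real \<Rightarrow> real \<Rightarrow> real"
  assumes "continuous_on (Omega T0) (\<lambda>x. f (fst x) (snd x))" "0 < t" "t \<le> T0"
  shows "(f t has_integral integral {0..t} (f t)) {0..t}"
  using integrable_continuous_real[OF slice_continuous[OF assms]] by (rule integrable_integral)

lemma energy_parts:
  assumes "0 < t" "t \<le> T0"
  shows E_has_integral: "(edens t has_integral E t) {0..t}"
    and kin_t_has_integral: "((\<lambda>r. r * (ut t r)\<^sup>2) has_integral kin_t t) {0..t}"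
    and kin_r_has_integral: "((\<lambda>r. r * (ur t r)\<^sup>2) has_integral kin_r t) {0..t}"
    and skyrme_t_has_integral: "((\<lambda>r. r * (\<alpha>\<^sup>2 * (k t r)\<^sup>2 * (ut t r)\<^sup>2)) has_integral skyrme_t t) {0..t}"
    and skyrme_r_has_integral: "((\<lambda>r. r * (\<alpha>\<^sup>2 * (k t r)\<^sup>2 * (ur t r)\<^sup>2)) has_integral skyrme_r t) {0..t}"
    and pot_has_integral: "((\<lambda>r. r * (k t r)\<^sup>2) has_integral pot t) {0..t}"
  unfolding E_def kin_t_def kin_r_def skyrme_t_def skyrme_r_def pot_def
  subgoal by (rule slice_integrable[OF _ assms, where f = "edens"]) (intro continuous_intros)
  subgoal by (rule slice_integrable[OF _ assms, where f = "\<lambda>t r. r * (ut t r)\<^sup>2"]) (intro continuous_intros)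
  subgoal by (rule slice_integrable[OF _ assms, where f = "\<lambda>t r. r * (ur t r)\<^sup>2"]) (intro continuous_intros)
  subgoal by (rule slice_integrable[OF _ assms, where f = "\<lambda>t r. r * (\<alpha>\<^sup>2 * (k t r)\<^sup>2 * (ut t r)\<^sup>2)"]) (intro continuous_intros)
  subgoal by (rule slice_integrable[OF _ assms, where f = "\<lambda>t r. r * (\<alpha>\<^sup>2 * (k t r)\<^sup>2 * (ur t r)\<^sup>2)"]) (intro continuous_intros)
  subgoal by (rule slice_integrable[OF _ assms, where f = "\<lambda>t r. r * (k t r)\<^sup>2"]) (intro continuous_intros)
  done

lemma energy_parts_nonneg:
  assumes "0 < t" "t \<le> T0"
  shows "0 \<le> kin_t t" "0 \<le> kin_r t" "0 \<le> skyrme_t t" "0 \<le> skyrme_r t" "0 \<le> pot t"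
  using energy_parts(2-)[OF assms, THEN has_integral_nonneg] by auto

lemma E_eq:
  assumes "0 < t" "t \<le> T0"
  shows "E t = (kin_t t + kin_r t + skyrme_t t + skyrme_r t + pot t) / 2"
proof -
  have "((\<lambda>r. (r * (ut t r)\<^sup>2 + r * (ur t r)\<^sup>2 + r * (\<alpha>\<^sup>2 * (k t r)\<^sup>2 * (ut t r)\<^sup>2)
      + r * (\<alpha>\<^sup>2 * (k t r)\<^sup>2 * (ur t r)\<^sup>2) + r * (k t r)\<^sup>2) / 2) has_integral
      (kin_t t + kin_r t + skyrme_t t + skyrme_r t + pot t) / 2) {0..t}"
    by (intro has_integral_divide has_integral_add energy_parts[OF assms])
  also have "(\<lambda>r. (r * (ut t r)\<^sup>2 + r * (ur t r)\<^sup>2 + r * (\<alpha>\<^sup>2 * (k t r)\<^sup>2 * (ut t r)\<^sup>2)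
      + r * (\<alpha>\<^sup>2 * (k t r)\<^sup>2 * (ur t r)\<^sup>2) + r * (k t r)\<^sup>2) / 2) = edens t"
    by (auto simp: edens_def fun_eq_iff algebra_simps)
  finally show ?thesis using E_has_integral[OF assms] has_integral_unique by blast
qed

lemma E_nonneg: "0 < t \<Longrightarrow> t \<le> T0 \<Longrightarrow> 0 \<le> E t"
  using E_eq[of t] energy_parts_nonneg[of t] by simp

definition flux :: "real \<Rightarrow> real" where "flux t = edens t t + mdens t t"

text \<open>Only the derivative of u tangent to the boundary r = t enters, and it enters as a
  square; this gives the sign of the flux.\<close>

lemma flux_eq: "flux t = t * ((1 + \<alpha>\<^sup>2 * (k t t)\<^sup>2) * (ut t t + ur t t)\<^sup>2 + (k t t)\<^sup>2) / 2"
  by (simp add: flux_def edens_def mdens_def field_simps power2_eq_square)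

lemma flux_nonneg: "0 \<le> t \<Longrightarrow> 0 \<le> flux t"
  by (simp add: flux_eq)

text \<open>Terms without a factor r carry \<open>ut\<close> or sin u, which vanish on the axis.
  Thus no flux passes through the axis.\<close>

lemma at_centre:
  assumes "0 < t" "t \<le> T0"
  shows "edens t 0 = 0" "edens_t t 0 = 0" "mdens t 0 = 0" "mdens_t t 0 = 0" "mflux t 0 = 0"
    "vdens t 0 = 0" "vdens_t t 0 = 0" "vflux t 0 = 0"
  using assms by (simp_all add: edens_def edens_t_def mdens_def mdens_t_def mflux_def vdens_def vdens_t_def vflux_def u0 ut0)

lemma E_deriv:
  assumes "0 < S" "S \<le> t" "t \<le> T" "T \<le> T0"
  shows "(E has_real_derivative flux t) (at t within {S..T})"
proof -
  note sub = continuous_on_subset[OF _ trunc_cone_subset[OF assms(1,4)]]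
  have "((\<lambda>t. integral {0..t} (edens t)) has_real_derivative
      edens t t + mdens t t - mdens t 0 + integral {0..t} (\<lambda>_. 0)) (at t within {S..T})"
  proof (rule cone_integral_has_derivative[where Ft = edens_t and Fr = edens_r and Gr = mdens_r, OF assms(1-3)])
    show "continuous_on (trunc_cone S T) (\<lambda>x. edens (fst x) (snd x))"
      "continuous_on (trunc_cone S T) (\<lambda>x. edens_t (fst x) (snd x))"
      "continuous_on (trunc_cone S T) (\<lambda>x. edens_r (fst x) (snd x))"
      "continuous_on (trunc_cone S T) (\<lambda>x. mdens (fst x) (snd x))"
      by (rule sub, intro continuous_intros)+
  qed (use assms in \<open>auto intro!: edens_ray edens_radial mdens_radial at_centre energy_law simp: Omega_def\<close>)
  then show ?thesis
    using assms at_centre[of t] by (simp add: flux_def E_def[abs_def])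
qed

lemma E_mono:
  assumes "0 < s" "s \<le> t" "t \<le> T0"
  shows "E s \<le> E t"
  by (rule nondecreasing_if_derivative_nonneg[where f = E and f' = flux])
    (use assms in \<open>auto intro!: E_deriv flux_nonneg\<close>)

text \<open>As u = 0 on the axis, 1 - cos u is the integral of sin u \<open>ur\<close> = s k
  \<open>ur\<close> over 0 \<le> s \<le> r. Cauchy-Schwarz with weight s bounds it by the Skyrme
  part of the energy and the integral r^2 / 2 of s.\<close>

lemma one_minus_cos_bound:
  assumes "(t, r) \<in> Omega T0"
  shows "\<alpha>\<^sup>2 * (1 - cos (u t r))\<^sup>2 \<le> r\<^sup>2 / 2 * skyrme_r t"
proof (cases "r = 0")
  case True
  then show ?thesis using assms u0[of t] by (auto simp: Omega_def)
next
  case False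
  with assms have r: "0 < r" "r \<le> t" and t: "0 < t" "t \<le> T0" by (auto simp: Omega_def)
  have O: "(t, s) \<in> Omega T0" if "s \<in> {0..r}" for s using that r t by (auto simp: Omega_def)
  define N where "N = skyrme_r t / \<alpha>\<^sup>2"
  have N0: "0 \<le> N" using energy_parts_nonneg(4)[OF t] by (simp add: N_def)
  have hN: "((\<lambda>s. s * ((k t s)\<^sup>2 * (ur t s)\<^sup>2)) has_integral N) {0..t}"
    using has_integral_divide[OF skyrme_r_has_integral[OF t], of "\<alpha>\<^sup>2"] \<alpha> by (simp add: N_def)
  define N' where "N' = integral {0..r} (\<lambda>s. s * ((k t s)\<^sup>2 * (ur t s)\<^sup>2))"
  have cN: "continuous_on {0..t} (\<lambda>s. s * ((k t s)\<^sup>2 * (ur t s)\<^sup>2))"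
    by (rule slice_continuous[OF _ t, where f = "\<lambda>t s. s * ((k t s)\<^sup>2 * (ur t s)\<^sup>2)"]) (intro continuous_intros)
  have hN': "((\<lambda>s. s * ((k t s)\<^sup>2 * (ur t s)\<^sup>2)) has_integral N') {0..r}"
    unfolding N'_def using r by (intro integrable_integral integrable_continuous_real continuous_on_subset[OF cN]) auto
  have N'N: "N' \<le> N"
    using r by (intro has_integral_subset_le[OF _ hN' hN]) auto
  \<comment> \<open>The factors come from integrating s p \<le> \<theta> s / 2 + s p^2 / (2
    \<theta>) with p = k \<open>ur\<close>.\<close>
  have sq: "(1 - cos (u t r))\<^sup>2 \<le> 4 * (r\<^sup>2 / 4) * (N / 2)"
  proof (rule square_le_of_le_weighted)
    fix \<theta> :: real assume \<theta>: "0 < \<theta>"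
    have "((\<lambda>s. sin (u t s) * ur t s) has_integral - cos (u t r) - - cos (u t 0)) {0..r}"
    proof (rule fundamental_theorem_of_calculus)
      show "((\<lambda>s. - cos (u t s)) has_vector_derivative sin (u t s) * ur t s) (at s within {0..r})"
        if "s \<in> {0..r}" for s
        unfolding has_real_derivative_iff_has_vector_derivative[symmetric]
        by (rule has_field_derivative_at_within) (auto intro!: derivative_eq_intros u_radial O that)
    qed (use r in auto)
    then have 1: "((\<lambda>s. sin (u t s) * ur t s) has_integral 1 - cos (u t r)) {0..r}"
      using u0[OF t] by simp
    have "((\<lambda>s. s) has_integral r\<^sup>2 / 2 - 0\<^sup>2 / 2) {0..r}"
      using r by (intro fundamental_theorem_of_calculus)
        (auto intro!: derivative_eq_intros simp: has_real_derivative_iff_has_vector_derivative[symmetric])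
    then have 2: "((\<lambda>s. \<theta> / 2 * s + s * ((k t s)\<^sup>2 * (ur t s)\<^sup>2) / (2 * \<theta>)) has_integral
        \<theta> / 2 * (r\<^sup>2 / 2) + N' / (2 * \<theta>)) {0..r}"
      by (intro has_integral_add has_integral_mult_right has_integral_divide hN') simp
    have "1 - cos (u t r) \<le> \<theta> / 2 * (r\<^sup>2 / 2) + N' / (2 * \<theta>)"
    proof (rule has_integral_le[OF 1 2])
      fix s assume s: "s \<in> {0..r}"
      define p where "p = k t s * ur t s"
      have "0 \<le> s * (\<theta> - p)\<^sup>2 / (2 * \<theta>)" using s \<theta> by simp
      also have "\<dots> = \<theta> / 2 * s + s * p\<^sup>2 / (2 * \<theta>) - s * p"
        using \<theta> by (simp add: field_simps power2_eq_square)
      finally show "sin (u t s) * ur t s \<le> \<theta> / 2 * s + s * ((k t s)\<^sup>2 * (ur t s)\<^sup>2) / (2 * \<theta>)"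
        by (simp add: rk[OF O[OF s], symmetric] p_def power_mult_distrib)
    qed
    also have "\<dots> \<le> \<theta> / 2 * (r\<^sup>2 / 2) + N / (2 * \<theta>)"
      using N'N \<theta> by (intro add_left_mono divide_right_mono) auto
    finally show "1 - cos (u t r) \<le> \<theta> * (r\<^sup>2 / 4) + N / 2 / \<theta>" by simp
  qed (use r N0 in auto)
  have "\<alpha>\<^sup>2 * (1 - cos (u t r))\<^sup>2 \<le> \<alpha>\<^sup>2 * (4 * (r\<^sup>2 / 4) * (N / 2))"
    using sq by (intro mult_left_mono) auto
  then show ?thesis using \<alpha> by (simp add: N_def)
qed

text \<open>Off the axis the left side is \<alpha>^2 sin^4 u / r^2, and sin^2 u \<le> 2 (1 - cos u)
  reduces it to the previous lemma. This is the bound on q s^2 needed for the virial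
  density.\<close>

lemma k_sin_bound:
  assumes "(t, r) \<in> Omega T0"
  shows "\<alpha>\<^sup>2 * (k t r)\<^sup>2 * (sin (u t r))\<^sup>2 \<le> 2 * skyrme_r t"
proof (cases "r = 0")
  case True
  then show ?thesis using assms u0[of t] energy_parts_nonneg(4)[of t] by (auto simp: Omega_def)
next
  case False
  with assms have r: "0 < r" by (auto simp: Omega_def)
  have "r\<^sup>2 * (\<alpha>\<^sup>2 * (k t r)\<^sup>2 * (sin (u t r))\<^sup>2) = \<alpha>\<^sup>2 * ((sin (u t r))\<^sup>2)\<^sup>2"
    by (simp add: rk[OF assms, symmetric] power_mult_distrib power2_eq_square)
  also have "\<dots> \<le> \<alpha>\<^sup>2 * (2 * (1 - cos (u t r)))\<^sup>2"
    by (intro mult_left_mono power_mono sin_sq_le) auto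
  also have "\<dots> = 4 * (\<alpha>\<^sup>2 * (1 - cos (u t r))\<^sup>2)" by (simp only: power_mult_distrib) simp
  also have "\<dots> \<le> r\<^sup>2 * (2 * skyrme_r t)" using one_minus_cos_bound[OF assms] by (simp add: mult_ac)
  finally show ?thesis using r by simp
qed

text \<open>Normalised so that sin^2 u \<le> 2 (1 - cos u) \<le> \<open>decay_const * r\<close>. It
  is uniform in time because \<open>skyrme_r t\<close> \<le> 2 \<open>E t\<close> \<le> 2
  \<open>E T0\<close>.\<close>

definition decay_const :: real where "decay_const = 2 * sqrt (E T0) / \<alpha>"

lemma decay_const_nonneg: "0 \<le> decay_const"
  using E_nonneg[of T0] T0 \<alpha> by (simp add: decay_const_def)

lemma one_minus_cos_le:
  assumes "(t, r) \<in> Omega T0"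
  shows "1 - cos (u t r) \<le> decay_const * r / 2"
proof -
  have t: "0 < t" "t \<le> T0" and r: "0 \<le> r" using assms by (auto simp: Omega_def)
  have "skyrme_r t \<le> 2 * E t" using E_eq[OF t] energy_parts_nonneg[OF t] by simp
  also have "\<dots> \<le> 2 * E T0" using E_mono[of t T0] t by simp
  finally have Y: "skyrme_r t \<le> 2 * E T0" .
  have "(\<alpha> * (1 - cos (u t r)))\<^sup>2 \<le> r\<^sup>2 / 2 * skyrme_r t"
    using one_minus_cos_bound[OF assms] by (simp add: power_mult_distrib)
  also have "\<dots> \<le> r\<^sup>2 / 2 * (2 * E T0)" using Y by (intro mult_left_mono) auto
  also have "\<dots> = (r * sqrt (E T0))\<^sup>2" using E_nonneg[of T0] T0 by (simp add: power_mult_distrib)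
  finally have "\<alpha> * (1 - cos (u t r)) \<le> r * sqrt (E T0)"
    by (rule power2_le_imp_le) (use r E_nonneg[of T0] T0 in auto)
  then show ?thesis using \<alpha> by (simp add: decay_const_def field_simps)
qed

lemma k_sq_bound:
  assumes "(t, r) \<in> Omega T0"
  shows "r * (k t r)\<^sup>2 \<le> decay_const"
proof (cases "r = 0")
  case True
  then show ?thesis using decay_const_nonneg by simp
next
  case False
  with assms have r: "0 < r" by (auto simp: Omega_def)
  have "r * (r * (k t r)\<^sup>2) = (sin (u t r))\<^sup>2"
    by (simp add: rk[OF assms, symmetric] power_mult_distrib power2_eq_square)
  also have "\<dots> \<le> r * decay_const" using sin_sq_le[of "u t r"] one_minus_cos_le[OF assms] by (simp add: mult.commute)
  finally show ?thesis using r by simp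
qed

lemma pot_le:
  assumes "0 < t" "t \<le> T0"
  shows "pot t \<le> decay_const * t"
proof -
  have "((\<lambda>r. decay_const) has_integral decay_const * t) {0..t}" using has_integral_const_real[of decay_const 0 t] assms by (simp add: mult.commute)
  with pot_has_integral[OF assms] show ?thesis
    by (rule has_integral_le) (use assms in \<open>auto intro!: k_sq_bound simp: Omega_def\<close>)
qed

section \<open>The virial multiplier\<close>

definition virial_moment :: "real \<Rightarrow> real \<Rightarrow> real" where
  "virial_moment S t = integral {0..t} (\<lambda>r. vdens t r / (t + S))"

lemma vdens_bound:
  assumes "(t, r) \<in> Omega T0" "0 \<le> S"
  shows "\<bar>vdens t r\<bar> / (t + S) \<le> r * ((ut t r)\<^sup>2 + (k t r)\<^sup>2 + \<alpha>\<^sup>2 * (k t r)\<^sup>2 * (ut t r)\<^sup>2 / 2) + r * (skyrme_r t / (t + S)\<^sup>2)"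
  unfolding vdens_def
  by (rule virial_boundary_pointwise)
    (use assms k_sin_bound[OF assms(1)] rk[OF assms(1)] in \<open>auto simp: Omega_def\<close>)

lemma skyrme_r_weight_has_integral:
  assumes "0 < t" "0 \<le> S"
  shows "((\<lambda>r. r * (skyrme_r t / (t + S)\<^sup>2)) has_integral t\<^sup>2 / 2 * (skyrme_r t / (t + S)\<^sup>2)) {0..t}"
proof -
  have "((\<lambda>r. r) has_integral t\<^sup>2 / 2 - 0\<^sup>2 / 2) {0..t}"
    using assms by (intro fundamental_theorem_of_calculus)
      (auto intro!: derivative_eq_intros simp: has_real_derivative_iff_has_vector_derivative[symmetric])
  from has_integral_mult_left[OF this, of "skyrme_r t / (t + S)\<^sup>2"] show ?thesis by simp
qed

lemma skyrme_r_weight_le: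
  assumes "0 < t" "t \<le> T0" "0 \<le> S"
  shows "t\<^sup>2 / 2 * (skyrme_r t / (t + S)\<^sup>2) \<le> skyrme_r t / 2"
proof -
  have "t\<^sup>2 \<le> (t + S)\<^sup>2" using assms by (intro power_mono) auto
  then have "t\<^sup>2 * skyrme_r t \<le> (t + S)\<^sup>2 * skyrme_r t"
    using energy_parts_nonneg(4)[OF assms(1,2)] by (intro mult_right_mono)
  then show ?thesis using assms by (simp add: field_simps)
qed

lemma virial_moment_has_integral:
  assumes "0 < t" "t \<le> T0"
  shows "((\<lambda>r. vdens t r / (t + S)) has_integral virial_moment S t) {0..t}"
proof -
  have "(vdens t has_integral integral {0..t} (vdens t)) {0..t}"
    by (rule slice_integrable[OF _ assms]) (intro continuous_intros)
  from has_integral_divide[OF this, of "t + S"] show ?thesis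
    unfolding virial_moment_def by (metis integral_unique)
qed

text \<open>The bound does not involve \<open>S\<close>, so these boundary terms stay bounded while
  the logarithm grows.\<close>

lemma virial_moment_bound:
  assumes "0 < t" "t \<le> T0" "0 \<le> S"
  shows "\<bar>virial_moment S t\<bar> \<le> 2 * E t"
proof -
  have i: "((\<lambda>r. r * (ut t r)\<^sup>2 + r * (k t r)\<^sup>2 + r * (\<alpha>\<^sup>2 * (k t r)\<^sup>2 * (ut t r)\<^sup>2) / 2
      + r * (skyrme_r t / (t + S)\<^sup>2)) has_integral
      kin_t t + pot t + skyrme_t t / 2 + t\<^sup>2 / 2 * (skyrme_r t / (t + S)\<^sup>2)) {0..t}" (is "(?f has_integral ?i) _")
    by (intro has_integral_add has_integral_divide energy_parts[OF assms(1,2)] skyrme_r_weight_has_integral assms)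
  have le: "\<bar>vdens t r / (t + S)\<bar> \<le> ?f r" if "r \<in> {0..t}" for r
    using vdens_bound[of t r S] that assms by (simp add: Omega_def abs_divide algebra_simps)
  have "virial_moment S t \<le> ?i"
    by (rule has_integral_le[OF virial_moment_has_integral[OF assms(1,2)] i]) (rule abs_le_D1[OF le])
  moreover have "- virial_moment S t \<le> ?i"
    by (rule has_integral_le[OF has_integral_neg[OF virial_moment_has_integral[OF assms(1,2)]] i])
      (rule abs_le_D2[OF le])
  moreover have "?i \<le> 2 * E t"
    using skyrme_r_weight_le[OF assms] E_eq[OF assms(1,2)] energy_parts_nonneg[OF assms(1,2)]
    by (simp add: field_simps)
  ultimately show ?thesis by (simp add: abs_le_iff)
qed

lemma virial_le:
  assumes "(t, r) \<in> Omega T0" "decay_const * t \<le> 1"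
  shows "virial t r \<le> r * (2 * (ut t r)\<^sup>2 + 8 * (\<alpha>\<^sup>2 * (k t r)\<^sup>2) * (ur t r)\<^sup>2 - (ur t r)\<^sup>2
    - \<alpha>\<^sup>2 * (k t r)\<^sup>2 * (ut t r)\<^sup>2 + 5 * (k t r)\<^sup>2)"
proof -
  have r: "0 \<le> r" "r \<le> t" using assms by (auto simp: Omega_def)
  have "decay_const * r \<le> decay_const * t" using r decay_const_nonneg by (intro mult_left_mono)
  \<comment> \<open>The smallness of \<open>t\<close> enters here: 1 - cos u \<le>
    \<open>decay_const * r / 2\<close> \<le> 1/2.\<close>
  then have c: "1 / 2 \<le> cos (u t r)" using one_minus_cos_le[OF assms(1)] assms(2) by simp
  show ?thesis
    using virial_pointwise_bound[OF r(1) _ c, of "\<alpha>\<^sup>2 * (k t r)\<^sup>2" "ut t r" "ur t r" "k t r"] rk[OF assms(1)]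
    unfolding virial_def by (simp add: mult.assoc)
qed

lemma cont_virial [continuous_intros]: "continuous_on (Omega T0) (\<lambda>x. virial (fst x) (snd x))"
proof -
  have "1 + \<alpha>\<^sup>2 * x\<^sup>2 \<noteq> 0" for x :: real
    by (metis add_pos_nonneg less_irrefl mult_nonneg_nonneg zero_le_power2 zero_less_one)
  then show ?thesis unfolding virial_def by (intro continuous_intros ballI)
qed

lemma virial_moment_deriv:
  assumes "0 < S" "S \<le> t" "t \<le> T" "T \<le> T0"
  shows "(virial_moment S has_real_derivative
      (vdens t t + vflux t t) / (t + S) + integral {0..t} (\<lambda>r. virial t r / (t + S) - vdens t r / (t + S)\<^sup>2))
      (at t within {S..T})"
proof -
  note sub = continuous_on_subset[OF _ trunc_cone_subset[OF assms(1,4)]]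
  have nz: "fst x + S \<noteq> 0" "(fst x + S)\<^sup>2 \<noteq> 0" if "x \<in> Omega T0" for x
    using that assms(1) by (auto simp: Omega_def)
  \<comment> \<open>The weight 1 / (t + S) does not depend on r, so it changes the virial law only
    by the extra source -\<open>vdens\<close> / (t + S)^2.\<close>
  have "((\<lambda>t. integral {0..t} (\<lambda>r. vdens t r / (t + S))) has_real_derivative
      vdens t t / (t + S) + vflux t t / (t + S) - vflux t 0 / (t + S)
        + integral {0..t} (\<lambda>r. virial t r / (t + S) - vdens t r / (t + S)\<^sup>2)) (at t within {S..T})"
  proof (rule cone_integral_has_derivative[where F = "\<lambda>t r. vdens t r / (t + S)" and G = "\<lambda>t r. vflux t r / (t + S)"
        and H = "\<lambda>t r. virial t r / (t + S) - vdens t r / (t + S)\<^sup>2"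
        and Ft = "\<lambda>t r. vdens_t t r / (t + S) - vdens t r / (t + S)\<^sup>2"
        and Fr = "\<lambda>t r. vdens_r t r / (t + S)" and Gr = "\<lambda>t r. vflux_r t r / (t + S)", OF assms(1-3)])
    show "continuous_on (trunc_cone S T) (\<lambda>x. vdens (fst x) (snd x) / (fst x + S))"
      "continuous_on (trunc_cone S T) (\<lambda>x. vdens_t (fst x) (snd x) / (fst x + S) - vdens (fst x) (snd x) / (fst x + S)\<^sup>2)"
      "continuous_on (trunc_cone S T) (\<lambda>x. vdens_r (fst x) (snd x) / (fst x + S))"
      "continuous_on (trunc_cone S T) (\<lambda>x. vflux (fst x) (snd x) / (fst x + S))"
      "continuous_on (trunc_cone S T) (\<lambda>x. virial (fst x) (snd x) / (fst x + S) - vdens (fst x) (snd x) / (fst x + S)\<^sup>2)"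
      by (rule sub, intro continuous_intros ballI nz, assumption+)+
  next
    fix t y :: real assume t: "S \<le> t" "t \<le> T" "0 < y" "y \<le> 1"
    have nz: "t + S \<noteq> 0" using t assms by simp
    show "((\<lambda>s. vdens s (s * y) / (s + S)) has_real_derivative
        vdens_t t (t * y) / (t + S) - vdens t (t * y) / (t + S)\<^sup>2 + y * (vdens_r t (t * y) / (t + S))) (at t within {S..T})"
      by (rule derivative_eq_intros vdens_ray assms t refl nz)+
        (use nz in \<open>simp add: divide_simps power2_eq_square\<close>, simp add: algebra_simps)
  next
    fix t r assume t: "S \<le> t" "t \<le> T" "0 < r" "r < t"
    then have O: "(t, r) \<in> Omega T0" using assms by (auto simp: Omega_def)
    show "((\<lambda>r. vdens t r / (t + S)) has_real_derivative vdens_r t r / (t + S)) (at r)"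
      "((\<lambda>r. vflux t r / (t + S)) has_real_derivative vflux_r t r / (t + S)) (at r)"
      by (intro DERIV_cdivide vdens_radial vflux_radial O t)+
    show "vdens_t t r / (t + S) - vdens t r / (t + S)\<^sup>2
      = vflux_r t r / (t + S) + (virial t r / (t + S) - vdens t r / (t + S)\<^sup>2)"
      by (simp add: virial_law[OF O t(3)] add_divide_distrib)
  qed (use assms in \<open>auto simp: at_centre\<close>)
  then show ?thesis
    using assms at_centre[of t] by (simp add: virial_moment_def[abs_def] add_divide_distrib)
qed

text \<open>On r = t the density and the flux combine into \<open>ut\<close> + \<open>ur\<close>,
  which the energy flux controls. The pointwise bound is applied with \<tau> = t, and the resulting
  1 / t is at most 2 / (t + S) because S \<le> t.\<close>

lemma virial_flux_le:
  assumes "0 < S" "S \<le> t" "t \<le> T0"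
  shows "(vdens t t + vflux t t) / (t + S) \<le> 3 * flux t + 2 * skyrme_r t / (t + S)"
proof -
  have O: "(t, t) \<in> Omega T0" and t: "0 < t" using assms by (auto simp: Omega_def)
  define p q s where "p = ut t t + ur t t" and "q = \<alpha>\<^sup>2 * (k t t)\<^sup>2" and "s = sin (u t t)"
  have s: "s = t * k t t" using rk[OF O] by (simp add: s_def)
  have q: "0 \<le> q" "q * s\<^sup>2 \<le> 2 * skyrme_r t" using k_sin_bound[OF O] by (auto simp: q_def s_def)
  have "(vdens t t + vflux t t) / (t + S) \<le> \<bar>t * s * (2 - q) * p\<bar> / (t + S)"
    using t assms by (intro divide_right_mono) (auto simp: vdens_def vflux_def p_def q_def s_def algebra_simps abs_le_iff)
  also have "\<dots> \<le> \<bar>t * s * (2 - q) * p\<bar> / t"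
    using t assms by (intro divide_left_mono) auto
  also have "\<dots> \<le> t * (p\<^sup>2 + (k t t)\<^sup>2 + q * p\<^sup>2 / 2) + t * (skyrme_r t / t\<^sup>2)"
    using t q s by (intro virial_boundary_pointwise) auto
  also have "\<dots> \<le> 3 * flux t + skyrme_r t / t"
  proof -
    have "p\<^sup>2 + (k t t)\<^sup>2 + q * p\<^sup>2 / 2 \<le> 3 * (((1 + q) * p\<^sup>2 + (k t t)\<^sup>2) / 2)"
    proof -
      have "0 \<le> q * p\<^sup>2" using q by simp
      moreover have "3 * (((1 + q) * p\<^sup>2 + (k t t)\<^sup>2) / 2) = 3 / 2 * p\<^sup>2 + 3 / 2 * (q * p\<^sup>2) + 3 / 2 * (k t t)\<^sup>2"
        by (simp add: field_simps)
      ultimately show ?thesis using zero_le_power2[of p] zero_le_power2[of "k t t"] by linarith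
    qed
    from mult_left_mono[OF this, of t] t show ?thesis
      by (simp add: flux_eq p_def q_def power2_eq_square)
  qed
  also have "skyrme_r t / t \<le> 2 * skyrme_r t / (t + S)"
  proof -
    have "skyrme_r t * S \<le> skyrme_r t * t" using assms energy_parts_nonneg(4)[of t] t by (intro mult_left_mono) auto
    then show ?thesis using t assms by (simp add: field_simps)
  qed
  finally show ?thesis by simp
qed

text \<open>The constants add up the virial source, the differentiated weight and the boundary: 3 =
  2 + 1, 21/2 = 8 + 1/2 + 2, -1/2 = -1 + 1/2, 6 = 5 + 1.\<close>

lemma virial_moment_deriv_le:
  assumes "0 < S" "S \<le> t" "t \<le> T0" "decay_const * t \<le> 1"
  shows "(vdens t t + vflux t t) / (t + S) + integral {0..t} (\<lambda>r. virial t r / (t + S) - vdens t r / (t + S)\<^sup>2)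
    \<le> 3 * flux t + (3 * kin_t t + 21 / 2 * skyrme_r t - kin_r t - skyrme_t t / 2 + 6 * pot t) / (t + S)"
proof -
  have t: "0 < t" "t \<le> T0" using assms by auto
  have nz: "t + S > 0" using t assms by simp
  have "((\<lambda>r. virial t r / (t + S) - vdens t r / (t + S)\<^sup>2) has_integral
      integral {0..t} (\<lambda>r. virial t r / (t + S) - vdens t r / (t + S)\<^sup>2)) {0..t}"
    using slice_continuous[OF cont_virial t] slice_continuous[OF cont_vdens t] nz
    by (intro integrable_integral integrable_continuous_real continuous_intros) auto
  moreover have "((\<lambda>r. (3 * (r * (ut t r)\<^sup>2) + 8 * (r * (\<alpha>\<^sup>2 * (k t r)\<^sup>2 * (ur t r)\<^sup>2)) - r * (ur t r)\<^sup>2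
       - r * (\<alpha>\<^sup>2 * (k t r)\<^sup>2 * (ut t r)\<^sup>2) / 2 + 6 * (r * (k t r)\<^sup>2) + r * (skyrme_r t / (t + S)\<^sup>2)) / (t + S)) has_integral
      (3 * kin_t t + 8 * skyrme_r t - kin_r t - skyrme_t t / 2 + 6 * pot t + t\<^sup>2 / 2 * (skyrme_r t / (t + S)\<^sup>2)) / (t + S)) {0..t}"
    by (intro has_integral_divide has_integral_add has_integral_diff has_integral_mult_right
        energy_parts[OF t] skyrme_r_weight_has_integral) (use assms in auto)
  ultimately have "integral {0..t} (\<lambda>r. virial t r / (t + S) - vdens t r / (t + S)\<^sup>2)
    \<le> (3 * kin_t t + 8 * skyrme_r t - kin_r t - skyrme_t t / 2 + 6 * pot t + t\<^sup>2 / 2 * (skyrme_r t / (t + S)\<^sup>2)) / (t + S)"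
  proof (rule has_integral_le)
    fix r assume "r \<in> {0..t}"
    then have O: "(t, r) \<in> Omega T0" using t by (auto simp: Omega_def)
    have "virial t r / (t + S) - vdens t r / (t + S)\<^sup>2 = (virial t r - vdens t r / (t + S)) / (t + S)"
      by (simp add: diff_divide_distrib power2_eq_square)
    also have "\<dots> \<le> (3 * (r * (ut t r)\<^sup>2) + 8 * (r * (\<alpha>\<^sup>2 * (k t r)\<^sup>2 * (ur t r)\<^sup>2)) - r * (ur t r)\<^sup>2
       - r * (\<alpha>\<^sup>2 * (k t r)\<^sup>2 * (ut t r)\<^sup>2) / 2 + 6 * (r * (k t r)\<^sup>2) + r * (skyrme_r t / (t + S)\<^sup>2)) / (t + S)"
    proof (rule divide_right_mono)
      have "- (vdens t r / (t + S)) \<le> \<bar>vdens t r\<bar> / (t + S)"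
        using abs_ge_minus_self[of "vdens t r / (t + S)"] nz by (simp add: abs_divide)
      then show "virial t r - vdens t r / (t + S) \<le> 3 * (r * (ut t r)\<^sup>2) + 8 * (r * (\<alpha>\<^sup>2 * (k t r)\<^sup>2 * (ur t r)\<^sup>2)) - r * (ur t r)\<^sup>2
       - r * (\<alpha>\<^sup>2 * (k t r)\<^sup>2 * (ut t r)\<^sup>2) / 2 + 6 * (r * (k t r)\<^sup>2) + r * (skyrme_r t / (t + S)\<^sup>2)"
        using virial_le[OF O assms(4)] vdens_bound[OF O, of S] assms(1)
        by (simp add: algebra_simps)
    qed (use nz in simp)
    finally show "virial t r / (t + S) - vdens t r / (t + S)\<^sup>2 \<le> (3 * (r * (ut t r)\<^sup>2) + 8 * (r * (\<alpha>\<^sup>2 * (k t r)\<^sup>2 * (ur t r)\<^sup>2)) - r * (ur t r)\<^sup>2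
       - r * (\<alpha>\<^sup>2 * (k t r)\<^sup>2 * (ut t r)\<^sup>2) / 2 + 6 * (r * (k t r)\<^sup>2) + r * (skyrme_r t / (t + S)\<^sup>2)) / (t + S)" .
  qed
  also have "\<dots> \<le> (3 * kin_t t + 17 / 2 * skyrme_r t - kin_r t - skyrme_t t / 2 + 6 * pot t) / (t + S)"
    using skyrme_r_weight_le[OF t, of S] assms nz by (intro divide_right_mono) auto
  finally have "integral {0..t} (\<lambda>r. virial t r / (t + S) - vdens t r / (t + S)\<^sup>2)
    \<le> (3 * kin_t t + 17 / 2 * skyrme_r t - kin_r t - skyrme_t t / 2 + 6 * pot t) / (t + S)" .
  moreover have "(3 * kin_t t + 17 / 2 * skyrme_r t - kin_r t - skyrme_t t / 2 + 6 * pot t) / (t + S) + 2 * skyrme_r t / (t + S)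
    = (3 * kin_t t + 21 / 2 * skyrme_r t - kin_r t - skyrme_t t / 2 + 6 * pot t) / (t + S)"
    unfolding add_divide_distrib[symmetric] by simp
  ultimately show ?thesis using virial_flux_le[OF assms(1-3)] by linarith
qed

section \<open>The logarithmic multiplier\<close>

text \<open>The shift by \<open>S\<close> keeps the weight finite up to r = t, where it equals ln((t
  + S) / S).\<close>

definition log_weight :: "real \<Rightarrow> real \<Rightarrow> real \<Rightarrow> real" where
  "log_weight S t r = ln (t + S) - ln (t + S - r)"

definition log_moment :: "real \<Rightarrow> real \<Rightarrow> real" where
  "log_moment S t = integral {0..t} (\<lambda>r. log_weight S t r * mdens t r)"

text \<open>The first two terms come from the t- and r-derivatives of the weight, the last from the
  source of the momentum law.\<close>

definition log_bulk :: "real \<Rightarrow> real \<Rightarrow> real \<Rightarrow> real" where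
  "log_bulk S t r = (1 / (t + S) - 1 / (t + S - r)) * mdens t r - mflux t r / (t + S - r)
     - log_weight S t r * (((1 - \<alpha>\<^sup>2 * (k t r)\<^sup>2) * ((ut t r)\<^sup>2 - (ur t r)\<^sup>2) + (k t r)\<^sup>2) / 2)"

lemma log_weight_nonneg:
  assumes "0 < S" "0 \<le> r" "r \<le> t"
  shows "0 \<le> log_weight S t r"
  using assms by (simp add: log_weight_def)

lemma cont_log_weight:
  assumes "0 < S"
  shows "continuous_on (Omega T0) (\<lambda>x. log_weight S (fst x) (snd x))"
  unfolding log_weight_def using assms by (intro continuous_intros) (auto simp: Omega_def)

lemma cont_log_bulk:
  assumes "0 < S"
  shows "continuous_on (Omega T0) (\<lambda>x. log_bulk S (fst x) (snd x))"
  unfolding log_bulk_def using assms by (intro continuous_intros cont_log_weight) (auto simp: Omega_def)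

lemma log_moment_deriv:
  assumes "0 < S" "S \<le> t" "t \<le> T" "T \<le> T0"
  shows "(log_moment S has_real_derivative log_weight S t t * (mdens t t + mflux t t) + integral {0..t} (log_bulk S t))
      (at t within {S..T})"
proof -
  note sub = continuous_on_subset[OF _ trunc_cone_subset[OF assms(1,4)]]
  have nz: "fst x + S \<noteq> 0" "fst x + S - snd x \<noteq> 0" if "x \<in> Omega T0" for x
    using that assms(1) by (auto simp: Omega_def)
  have "((\<lambda>t. integral {0..t} (\<lambda>r. log_weight S t r * mdens t r)) has_real_derivative
      log_weight S t t * mdens t t + log_weight S t t * mflux t t - log_weight S t 0 * mflux t 0 + integral {0..t} (log_bulk S t)) (at t within {S..T})"
  proof (rule cone_integral_has_derivative[where F = "\<lambda>t r. log_weight S t r * mdens t r" and G = "\<lambda>t r. log_weight S t r * mflux t r"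
        and H = "log_bulk S" and Ft = "\<lambda>t r. (1 / (t + S) - 1 / (t + S - r)) * mdens t r + log_weight S t r * mdens_t t r"
        and Fr = "\<lambda>t r. mdens t r / (t + S - r) + log_weight S t r * mdens_r t r"
        and Gr = "\<lambda>t r. mflux t r / (t + S - r) + log_weight S t r * mflux_r t r", OF assms(1-3)])
    show "continuous_on (trunc_cone S T) (\<lambda>x. log_weight S (fst x) (snd x) * mdens (fst x) (snd x))"
      "continuous_on (trunc_cone S T) (\<lambda>x. (1 / (fst x + S) - 1 / (fst x + S - snd x)) * mdens (fst x) (snd x)
         + log_weight S (fst x) (snd x) * mdens_t (fst x) (snd x))"
      "continuous_on (trunc_cone S T) (\<lambda>x. mdens (fst x) (snd x) / (fst x + S - snd x) + log_weight S (fst x) (snd x) * mdens_r (fst x) (snd x))"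
      "continuous_on (trunc_cone S T) (\<lambda>x. log_weight S (fst x) (snd x) * mflux (fst x) (snd x))"
      "continuous_on (trunc_cone S T) (\<lambda>x. log_bulk S (fst x) (snd x))"
      by (rule sub, (intro continuous_intros cont_log_weight cont_log_bulk assms ballI nz; assumption?))+
  next
    fix t y :: real assume t: "S \<le> t" "t \<le> T" "0 < y" "y \<le> 1"
    have "t * y \<le> t" using t assms by (simp add: mult_left_le)
    then have pos: "t + S > 0" "t + S - t * y > 0" using t assms by linarith+
    have 1: "((\<lambda>s. log_weight S s (s * y)) has_real_derivative 1 / (t + S) - (1 - y) / (t + S - t * y)) (at t within {S..T})"
      unfolding log_weight_def using pos by (auto intro!: derivative_eq_intros simp: field_simps)
    show "((\<lambda>s. log_weight S s (s * y) * mdens s (s * y)) has_real_derivative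
        (1 / (t + S) - 1 / (t + S - t * y)) * mdens t (t * y) + log_weight S t (t * y) * mdens_t t (t * y)
        + y * (mdens t (t * y) / (t + S - t * y) + log_weight S t (t * y) * mdens_r t (t * y))) (at t within {S..T})"
      by (rule derivative_eq_intros 1 mdens_ray assms t refl)+
        (simp add: algebra_simps diff_divide_distrib)
  next
    fix t r assume t: "S \<le> t" "t \<le> T" "0 < r" "r < t"
    then have O: "(t, r) \<in> Omega T0" using assms by (auto simp: Omega_def)
    have pos: "t + S - r > 0" using t assms by auto
    have 1: "(log_weight S t has_real_derivative 1 / (t + S - r)) (at r)"
      unfolding log_weight_def[abs_def] using pos by (auto intro!: derivative_eq_intros simp: field_simps)
    show "((\<lambda>r. log_weight S t r * mdens t r) has_real_derivative mdens t r / (t + S - r) + log_weight S t r * mdens_r t r) (at r)"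
      "((\<lambda>r. log_weight S t r * mflux t r) has_real_derivative mflux t r / (t + S - r) + log_weight S t r * mflux_r t r) (at r)"
      by (rule derivative_eq_intros 1 mdens_radial[OF O t(3,4)] mflux_radial[OF O t(3,4)] refl | simp add: algebra_simps)+
    show "(1 / (t + S) - 1 / (t + S - r)) * mdens t r + log_weight S t r * mdens_t t r
      = mflux t r / (t + S - r) + log_weight S t r * mflux_r t r + log_bulk S t r"
      unfolding log_bulk_def momentum_law[OF O t(3)] by (simp only: right_diff_distrib)
  qed (use assms in \<open>auto simp: at_centre\<close>)
  then show ?thesis
    using assms at_centre[of t] by (simp add: log_moment_def[abs_def] distrib_left)
qed

text \<open>Twice the bulk term splits into a form in (\<open>ut\<close>, \<open>ur\<close>),
  \<open>q\<close> times the same form with the arguments exchanged, and a potential part.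
  Coercivity of the form yields \<open>ut\<close>^2 from the first and q \<open>ur\<close>^2 from
  the second; the potential part is bounded through r k^2 \<le> \<open>decay_const\<close>.\<close>

lemma log_bulk_le:
  assumes O: "(t, r) \<in> Omega T0" and "0 < S"
  shows "log_bulk S t r \<le> - (r * (ut t r)\<^sup>2 + r * (\<alpha>\<^sup>2 * (k t r)\<^sup>2 * (ur t r)\<^sup>2)) / (2 * (t + S)) + decay_const / 2 * (1 / (t + S - r))"
proof -
  have r: "0 \<le> r" "r < t + S" "0 < t" using assms by (auto simp: Omega_def)
  define \<tau> y L a b q g \<kappa> where "\<tau> = t + S" and "y = r / \<tau>" and "L = log_weight S t r" and "a = ut t r" and "b = ur t r"
    and "q = \<alpha>\<^sup>2 * (k t r)\<^sup>2" and "g = r / (\<tau> - r)" and "\<kappa> = k t r"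
  note defs = \<tau>_def y_def L_def a_def b_def q_def g_def \<kappa>_def
  have y: "0 \<le> y" "y < 1" using r by (auto simp: y_def \<tau>_def)
  have \<tau>: "0 < \<tau>" "0 < \<tau> - r" using r assms by (auto simp: \<tau>_def)
  have "1 - y = (\<tau> - r) / \<tau>" using \<tau> by (simp add: y_def diff_divide_distrib)
  then have gy: "y / (1 - y) = g" using \<tau> by (simp add: g_def y_def)
  have L: "y \<le> L" "L\<^sup>2 * (1 - y) \<le> y\<^sup>2"
    using log_multiplier_bounds[of r \<tau>] r by (auto simp: defs log_weight_def)
  have 1: "y * a\<^sup>2 \<le> g * (a\<^sup>2 + b\<^sup>2 + 2 * y * a * b) + L * (a\<^sup>2 - b\<^sup>2)"
    using log_multiplier_coercive[OF y L, of a b] by (simp add: gy)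
  \<comment> \<open>The arguments are exchanged because the factor 1 - q in the momentum source
    reverses the sign of the Skyrme part.\<close>
  have "y * b\<^sup>2 \<le> g * (b\<^sup>2 + a\<^sup>2 + 2 * y * b * a) + L * (b\<^sup>2 - a\<^sup>2)"
    using log_multiplier_coercive[OF y L, of b a] by (simp add: gy)
  then have 2: "q * (y * b\<^sup>2) \<le> q * (g * (b\<^sup>2 + a\<^sup>2 + 2 * y * b * a) + L * (b\<^sup>2 - a\<^sup>2))"
    by (intro mult_left_mono) (auto simp: q_def)
  have "r * \<kappa>\<^sup>2 / (\<tau> - r) \<le> decay_const / (\<tau> - r)"
    using k_sq_bound[OF O] \<tau> by (intro divide_right_mono) (auto simp: \<kappa>_def)
  then have 3: "g * \<kappa>\<^sup>2 \<le> decay_const / (\<tau> - r)" by (simp add: g_def)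
  have 4: "0 \<le> L * \<kappa>\<^sup>2" using L y by simp
  have "(1 / \<tau> - 1 / (\<tau> - r)) * (r * (1 + q) * a * b) = - (y * g * (1 + q) * a * b)"
    using \<tau> by (simp add: y_def g_def field_simps)
  moreover have "r * ((1 + q) * (a\<^sup>2 + b\<^sup>2) - \<kappa>\<^sup>2) / 2 / (\<tau> - r) = g * ((1 + q) * (a\<^sup>2 + b\<^sup>2) - \<kappa>\<^sup>2) / 2"
    by (simp add: g_def)
  ultimately have "log_bulk S t r = - (y * g * (1 + q) * a * b) - g * ((1 + q) * (a\<^sup>2 + b\<^sup>2) - \<kappa>\<^sup>2) / 2
      - L * (((1 - q) * (a\<^sup>2 - b\<^sup>2) + \<kappa>\<^sup>2) / 2)"
    unfolding log_bulk_def mdens_def mflux_def by (simp add: defs)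
  then have "2 * log_bulk S t r = - (g * (a\<^sup>2 + b\<^sup>2 + 2 * y * a * b) + L * (a\<^sup>2 - b\<^sup>2))
     - q * (g * (b\<^sup>2 + a\<^sup>2 + 2 * y * b * a) + L * (b\<^sup>2 - a\<^sup>2)) + g * \<kappa>\<^sup>2 - L * \<kappa>\<^sup>2"
    by (simp add: field_simps)
  then have "2 * log_bulk S t r \<le> - (y * a\<^sup>2) - q * (y * b\<^sup>2) + decay_const / (\<tau> - r)"
    using 1 2 3 4 by linarith
  then have "log_bulk S t r \<le> (- (y * a\<^sup>2) - q * (y * b\<^sup>2) + decay_const / (\<tau> - r)) / 2" by simp
  also have "\<dots> = - (r * a\<^sup>2 + r * (q * b\<^sup>2)) / (2 * \<tau>) + decay_const / 2 * (1 / (\<tau> - r))"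
    using \<tau> by (simp add: y_def field_simps)
  finally show ?thesis by (simp add: defs)
qed

text \<open>At r = t the weight is at most \<Lambda>, and the integral of 1 / (t + S - r) equals
  that same boundary weight. Hence both the flux and the potential error cost one factor \<Lambda>,
  while the gain has none.\<close>

lemma log_moment_deriv_le:
  assumes "0 < S" "S \<le> t" "t \<le> T" "T \<le> T0"
  defines "\<Lambda> \<equiv> ln (T + S) - ln S"
  shows "log_weight S t t * (mdens t t + mflux t t) + integral {0..t} (log_bulk S t)
    \<le> \<Lambda> * flux t - (kin_t t + skyrme_r t) / (2 * (t + S)) + decay_const / 2 * \<Lambda>"
proof -
  have t: "0 < t" "t \<le> T0" using assms by auto
  have log_weight: "log_weight S t t \<le> \<Lambda>" "0 \<le> log_weight S t t" using assms log_weight_nonneg[of S t t] by (auto simp: log_weight_def \<Lambda>_def)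
  have "mdens t t + mflux t t \<le> flux t" using t by (simp add: flux_def mflux_def edens_def field_simps)
  then have "log_weight S t t * (mdens t t + mflux t t) \<le> log_weight S t t * flux t" using log_weight by (intro mult_left_mono)
  also have "\<dots> \<le> \<Lambda> * flux t" using log_weight flux_nonneg[of t] t by (intro mult_right_mono) auto
  finally have 1: "log_weight S t t * (mdens t t + mflux t t) \<le> \<Lambda> * flux t" .
  have b: "(log_bulk S t has_integral integral {0..t} (log_bulk S t)) {0..t}"
    by (rule slice_integrable[OF cont_log_bulk t]) (use assms in auto)
  have "((\<lambda>r. 1 / (t + S - r)) has_integral log_weight S t t - log_weight S t 0) {0..t}"
    using assms t unfolding log_weight_def
    by (intro fundamental_theorem_of_calculus)
      (auto intro!: derivative_eq_intros simp: field_simps has_real_derivative_iff_has_vector_derivative[symmetric])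
  then have "((\<lambda>r. 1 / (t + S - r)) has_integral log_weight S t t) {0..t}" by (simp add: log_weight_def)
  then have "((\<lambda>r. - (r * (ut t r)\<^sup>2 + r * (\<alpha>\<^sup>2 * (k t r)\<^sup>2 * (ur t r)\<^sup>2)) / (2 * (t + S)) + decay_const / 2 * (1 / (t + S - r)))
    has_integral - (kin_t t + skyrme_r t) / (2 * (t + S)) + decay_const / 2 * log_weight S t t) {0..t}"
    by (intro has_integral_add has_integral_divide has_integral_neg has_integral_mult_right energy_parts[OF t])
  with b have "integral {0..t} (log_bulk S t) \<le> - (kin_t t + skyrme_r t) / (2 * (t + S)) + decay_const / 2 * log_weight S t t"
    by (rule has_integral_le) (rule log_bulk_le, use assms t in \<open>auto simp: Omega_def\<close>)
  also have "\<dots> \<le> - (kin_t t + skyrme_r t) / (2 * (t + S)) + decay_const / 2 * \<Lambda>"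
    using log_weight decay_const_nonneg by (intro add_left_mono mult_left_mono) auto
  finally show ?thesis using 1 unfolding minus_divide_left[symmetric] by linarith
qed

lemma abs_mdens_le_edens:
  assumes "0 \<le> r"
  shows "\<bar>mdens t r\<bar> \<le> edens t r"
proof -
  have "\<bar>2 * ut t r * ur t r\<bar> \<le> (ut t r)\<^sup>2 + (ur t r)\<^sup>2"
    using sum_squares_bound[of "ut t r" "ur t r"] sum_squares_bound[of "- ut t r" "ur t r"] by (simp add: abs_le_iff)
  then have "r * (1 + \<alpha>\<^sup>2 * (k t r)\<^sup>2) * \<bar>2 * ut t r * ur t r\<bar> \<le> r * (1 + \<alpha>\<^sup>2 * (k t r)\<^sup>2) * ((ut t r)\<^sup>2 + (ur t r)\<^sup>2)"
    using assms by (intro mult_left_mono) auto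
  moreover have "2 * \<bar>mdens t r\<bar> = r * (1 + \<alpha>\<^sup>2 * (k t r)\<^sup>2) * \<bar>2 * ut t r * ur t r\<bar>"
    using assms by (simp add: mdens_def abs_mult)
  moreover have "2 * edens t r = r * (1 + \<alpha>\<^sup>2 * (k t r)\<^sup>2) * ((ut t r)\<^sup>2 + (ur t r)\<^sup>2) + r * (k t r)\<^sup>2"
    by (simp add: edens_def algebra_simps)
  moreover have "0 \<le> r * (k t r)\<^sup>2" using assms by simp
  ultimately show ?thesis by linarith
qed

lemma log_moment_has_integral:
  assumes "0 < S" "0 < t" "t \<le> T0"
  shows "((\<lambda>r. log_weight S t r * mdens t r) has_integral log_moment S t) {0..t}"
  unfolding log_moment_def
  by (rule slice_integrable[where f = "\<lambda>t r. log_weight S t r * mdens t r"]) (intro continuous_intros cont_log_weight assms)+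

text \<open>At t = S the weight is at most ln 2, so the initial boundary term is bounded by the
  energy uniformly in \<open>S\<close>.\<close>

lemma log_moment_le_at_start:
  assumes "0 < S" "S \<le> T0"
  shows "log_moment S S \<le> ln 2 * E S"
proof (rule has_integral_le[OF log_moment_has_integral has_integral_mult_right[OF E_has_integral]])
  fix r assume r: "r \<in> {0..S}"
  have "ln (2 * S) - ln (2 * S - r) \<le> ln (2 * S) - ln S" using r assms by simp
  also have "\<dots> = ln 2" using assms by (simp add: ln_mult)
  finally have "log_weight S S r \<le> ln 2" by (simp add: log_weight_def)
  moreover have "0 \<le> log_weight S S r" using r assms by (intro log_weight_nonneg) auto
  moreover have "log_weight S S r * mdens S r \<le> log_weight S S r * edens S r"
    using abs_mdens_le_edens[of r S] r \<open>0 \<le> log_weight S S r\<close> by (intro mult_left_mono) auto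
  moreover have "log_weight S S r * edens S r \<le> ln 2 * edens S r"
    using abs_mdens_le_edens[of r S] r \<open>log_weight S S r \<le> ln 2\<close> by (intro mult_right_mono) auto
  ultimately show "log_weight S S r * mdens S r \<le> ln 2 * edens S r" by simp
qed (use assms in auto)

text \<open>For small \<open>S\<close> the weight is unbounded near r = T, but its integral over the
  slice is at most \<open>T\<close>. The density is bounded on this fixed slice, so \<open>K\<close>
  may depend on \<open>T\<close> but not on \<open>S\<close>.\<close>

lemma log_moment_ge_at_end:
  assumes "0 < T" "T \<le> T0"
  obtains K where "\<And>S. 0 < S \<Longrightarrow> - K \<le> log_moment S T"
proof -
  have "compact (edens T ` {0..T})"
    using slice_continuous[OF cont_edens assms] by (intro compact_continuous_image) auto
  then obtain B where B: "\<And>r. r \<in> {0..T} \<Longrightarrow> edens T r \<le> B"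
    using compact_imp_bounded bounded_real by (metis abs_le_D1 imageI)
  have B0: "0 \<le> B" using B[of 0] at_centre(1)[OF assms] assms by simp
  have "- (B * T) \<le> log_moment S T" if S: "0 < S" for S
  proof -
    define \<tau> where "\<tau> = T + S"
    have "((\<lambda>r. log_weight S T r) has_integral
        (T * ln \<tau> + (\<tau> - T) * ln (\<tau> - T) + T) - (0 * ln \<tau> + (\<tau> - 0) * ln (\<tau> - 0) + 0)) {0..T}"
    proof (rule fundamental_theorem_of_calculus)
      fix r assume "r \<in> {0..T}"
      then have "\<tau> - r > 0" using S by (simp add: \<tau>_def)
      then have "((\<lambda>r. r * ln \<tau> + (\<tau> - r) * ln (\<tau> - r) + r) has_real_derivative log_weight S T r) (at r)"
        unfolding log_weight_def \<tau>_def[symmetric] by (auto intro!: derivative_eq_intros)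
      then show "((\<lambda>r. r * ln \<tau> + (\<tau> - r) * ln (\<tau> - r) + r) has_vector_derivative log_weight S T r) (at r within {0..T})"
        by (simp add: has_real_derivative_iff_has_vector_derivative has_vector_derivative_at_within)
    qed (use assms in auto)
    from has_integral_mult_right[OF this, of B]
    have i: "((\<lambda>r. B * log_weight S T r) has_integral B * (T - S * log_weight S T T)) {0..T}"
      by (simp add: \<tau>_def log_weight_def algebra_simps)
    have "- log_moment S T \<le> B * (T - S * log_weight S T T)"
    proof (rule has_integral_le[OF has_integral_neg[OF log_moment_has_integral] i])
      fix r assume r: "r \<in> {0..T}"
      have log_weight: "0 \<le> log_weight S T r" using r S by (intro log_weight_nonneg) auto
      have "- mdens T r \<le> B" using abs_mdens_le_edens[of r T] B[OF r] r by auto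
      from mult_left_mono[OF this log_weight] show "- (log_weight S T r * mdens T r) \<le> B * log_weight S T r" by (simp add: mult.commute)
    qed (use assms S in auto)
    also have "\<dots> \<le> B * T"
      using B0 S assms log_weight_nonneg[of S T T] by (intro mult_left_mono) auto
    finally show ?thesis by simp
  qed
  then show thesis using that by blast
qed

section \<open>Decay of the energy\<close>

text \<open>All bounds on derivatives are collected in one function \<open>V\<close> that turns out
  nondecreasing; \<Lambda> is frozen at the final time. Comparing \<open>V\<close> at
  \<open>S\<close> and \<open>T\<close> is the integrated estimate.\<close>

lemma log_averaged_energy:
  assumes S: "0 < S" "S \<le> T" and T: "T \<le> T0" "decay_const * T \<le> 1"
    and E0: "\<And>t. 0 < t \<Longrightarrow> t \<le> T0 \<Longrightarrow> E0 \<le> E t"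
  defines "\<Lambda> \<equiv> ln (T + S) - ln S"
  shows "E0 * (ln (T + S) - ln (S + S)) \<le> (24 * \<Lambda> + 3) * (E T - E S) + (12 * \<Lambda> + 7) * decay_const * (T - S)
    + 24 * (log_moment S S - log_moment S T) + (virial_moment S S - virial_moment S T)"
proof -
  define dlog where "dlog t = log_weight S t t * (mdens t t + mflux t t) + integral {0..t} (log_bulk S t)" for t
  define dvir where "dvir t = (vdens t t + vflux t t) / (t + S)
    + integral {0..t} (\<lambda>r. virial t r / (t + S) - vdens t r / (t + S)\<^sup>2)" for t
  define V where "V t = (24 * \<Lambda> + 3) * E t + (12 * \<Lambda> + 7) * decay_const * t - E0 * ln (t + S) - 24 * log_moment S t - virial_moment S t" for t
  have "V S \<le> V T"
  proof (rule nondecreasing_if_derivative_nonneg[where f = V and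
        f' = "\<lambda>t. (24 * \<Lambda> + 3) * flux t + (12 * \<Lambda> + 7) * decay_const - E0 / (t + S) - 24 * dlog t - dvir t"])
    fix t assume "t \<in> {S..T}"
    then have t: "S \<le> t" "t \<le> T" by auto
    have t0: "0 < t" "t \<le> T0" and \<tau>: "0 < t + S" using t S T by auto
    have Ct: "decay_const * t \<le> 1"
      using mult_left_mono[OF t(2) decay_const_nonneg] T(2) by simp
    have 1: "(log_moment S has_real_derivative dlog t) (at t within {S..T})"
      unfolding dlog_def by (intro log_moment_deriv S t T)
    have 2: "(virial_moment S has_real_derivative dvir t) (at t within {S..T})"
      unfolding dvir_def by (intro virial_moment_deriv S t T)
    have 3: "(E has_real_derivative flux t) (at t within {S..T})"
      by (intro E_deriv S t T)
    show "(V has_real_derivative (24 * \<Lambda> + 3) * flux t + (12 * \<Lambda> + 7) * decay_const - E0 / (t + S) - 24 * dlog t - dvir t)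
        (at t within {S..T})"
      unfolding V_def using \<tau> by (auto intro!: derivative_eq_intros 1 2 3)
    define \<tau> where "\<tau> = t + S"
    have \<tau>: "0 < \<tau>" "t \<le> \<tau>" using t0 S by (auto simp: \<tau>_def)
    have b1: "dlog t \<le> \<Lambda> * flux t - (kin_t t + skyrme_r t) / (2 * \<tau>) + decay_const / 2 * \<Lambda>"
      unfolding dlog_def \<tau>_def \<Lambda>_def by (intro log_moment_deriv_le S t T)
    have b2: "dvir t \<le> 3 * flux t + (3 * kin_t t + 21 / 2 * skyrme_r t - kin_r t - skyrme_t t / 2 + 6 * pot t) / \<tau>"
      unfolding dvir_def \<tau>_def by (intro virial_moment_deriv_le S t t0 Ct)
    have "pot t \<le> decay_const * \<tau>"
      using pot_le[OF t0] mult_left_mono[OF \<tau>(2) decay_const_nonneg] by simp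
    then have pot: "pot t / \<tau> \<le> decay_const" using \<tau> by (simp add: divide_le_eq)
    \<comment> \<open>The factor 24 makes the logarithmic gain 12 (\<open>kin_t\<close> +
      \<open>skyrme_r\<close>), more than the 3 and 21/2 lost by the virial estimate.\<close>
    have "(3 * kin_t t + 21 / 2 * skyrme_r t - kin_r t - skyrme_t t / 2 + 6 * pot t) / \<tau> - 24 * ((kin_t t + skyrme_r t) / (2 * \<tau>))
      = (- 9 * kin_t t - 3 / 2 * skyrme_r t - kin_r t - skyrme_t t / 2 + 6 * pot t) / \<tau>"
      using \<tau> by (simp add: field_simps)
    \<comment> \<open>Each kinetic coefficient is now at most -1/2, which yields -\<open>E t\<close>
      up to the potential part: 6 \<le> -1/2 + 7.\<close>
    also have "\<dots> \<le> (- E0 + 7 * pot t) / \<tau>"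
      using E0[OF t0] E_eq[OF t0] energy_parts_nonneg[OF t0] \<tau> by (intro divide_right_mono) auto
    also have "\<dots> = - (E0 / \<tau>) + 7 * (pot t / \<tau>)" by (simp add: diff_divide_distrib)
    finally have "(3 * kin_t t + 21 / 2 * skyrme_r t - kin_r t - skyrme_t t / 2 + 6 * pot t) / \<tau> - 24 * ((kin_t t + skyrme_r t) / (2 * \<tau>))
      \<le> - (E0 / \<tau>) + 7 * decay_const" using pot by linarith
    moreover have "24 * dlog t \<le> 24 * (\<Lambda> * flux t) - 24 * ((kin_t t + skyrme_r t) / (2 * \<tau>)) + 12 * (\<Lambda> * decay_const)"
    proof -
      define z where "z = (kin_t t + skyrme_r t) / (2 * \<tau>)"
      show ?thesis using b1 unfolding z_def[symmetric] by (simp add: algebra_simps)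
    qed
    moreover have "(24 * \<Lambda> + 3) * flux t + (12 * \<Lambda> + 7) * decay_const = 24 * (\<Lambda> * flux t) + 3 * flux t + 12 * (\<Lambda> * decay_const) + 7 * decay_const"
      by (simp add: algebra_simps)
    ultimately show "0 \<le> (24 * \<Lambda> + 3) * flux t + (12 * \<Lambda> + 7) * decay_const - E0 / (t + S) - 24 * dlog t - dvir t"
      using b2 unfolding \<tau>_def[symmetric] by linarith
  qed (use S in auto)
  then show ?thesis by (simp add: V_def algebra_simps)
qed

text \<open>For fixed \<open>T\<close> both sides of the averaged estimate grow like \<Lambda> as
  \<open>S\<close> tends to 0; the claim compares the coefficients of \<Lambda>.\<close>

lemma energy_limit_bound:
  assumes T: "0 < T" "T \<le> T0" "decay_const * T \<le> 1"
    and E0: "0 \<le> E0" "\<And>t. 0 < t \<Longrightarrow> t \<le> T0 \<Longrightarrow> E0 \<le> E t"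
  shows "E0 \<le> 24 * (E T - E0) + 12 * decay_const * T"
proof (rule ccontr)
  define B where "B = 24 * (E T - E0) + 12 * decay_const * T"
  assume "\<not> ?thesis"
  then have B: "E0 - B > 0" by (simp add: B_def)
  obtain K where K: "\<And>S. 0 < S \<Longrightarrow> - K \<le> log_moment S T"
    using log_moment_ge_at_end[OF T(1,2)] by blast
  \<comment> \<open>All terms that stay bounded as \<open>S\<close> tends to 0.\<close>
  define M where "M = 3 * (E T - E0) + 7 * (decay_const * T) + 24 * (ln 2 * E T) + 24 * K + 4 * E T + E0 * ln 2"
  \<comment> \<open>Chosen to exceed M / (E0 - B) strictly and be positive; the choice of
    \<open>S\<close> below then forces \<Lambda> \<ge> N.\<close>
  define N where "N = max 0 (M / (E0 - B)) + 1"
  have N: "0 < N" "M < N * (E0 - B)"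
    using B by (auto simp: N_def pos_divide_less_eq[symmetric])
  define S where "S = T * exp (- N)"
  have S: "0 < S" "S \<le> T" using T N by (auto simp: S_def)
  define \<Lambda> where "\<Lambda> = ln (T + S) - ln S"
  have "ln S = ln T - N" using T by (simp add: S_def ln_mult)
  moreover have "ln T \<le> ln (T + S)" using T S by simp
  ultimately have \<Lambda>: "N \<le> \<Lambda>" by (simp add: \<Lambda>_def)
  then have \<Lambda>0: "0 \<le> \<Lambda>" using N by simp
  have ES: "E0 \<le> E S" "E S \<le> E T" using E0 E_mono S T by auto
  have "E0 * (ln (T + S) - ln (S + S)) \<le> (24 * \<Lambda> + 3) * (E T - E S) + (12 * \<Lambda> + 7) * decay_const * (T - S)
    + 24 * (log_moment S S - log_moment S T) + (virial_moment S S - virial_moment S T)"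
    unfolding \<Lambda>_def by (rule log_averaged_energy[OF S T(2,3) E0(2)])
  also have "ln (T + S) - ln (S + S) = \<Lambda> - ln 2"
    using S ln_mult[of 2 S] by (simp add: \<Lambda>_def)
  also have "(24 * \<Lambda> + 3) * (E T - E S) + (12 * \<Lambda> + 7) * decay_const * (T - S) + 24 * (log_moment S S - log_moment S T) + (virial_moment S S - virial_moment S T)
    \<le> (24 * \<Lambda> + 3) * (E T - E0) + (12 * \<Lambda> + 7) * decay_const * T + 24 * (ln 2 * E T + K) + 4 * E T"
  proof (intro add_mono)
    show "(24 * \<Lambda> + 3) * (E T - E S) \<le> (24 * \<Lambda> + 3) * (E T - E0)"
      using \<Lambda>0 ES by (intro mult_left_mono) auto
    show "(12 * \<Lambda> + 7) * decay_const * (T - S) \<le> (12 * \<Lambda> + 7) * decay_const * T"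
      using \<Lambda>0 decay_const_nonneg S by (intro mult_left_mono mult_nonneg_nonneg) auto
    have "log_moment S S \<le> ln 2 * E S" using S T by (intro log_moment_le_at_start) auto
    also have "\<dots> \<le> ln 2 * E T" using ES by (intro mult_left_mono) auto
    finally show "24 * (log_moment S S - log_moment S T) \<le> 24 * (ln 2 * E T + K)" using K[OF S(1)] by simp
    have "\<bar>virial_moment S S\<bar> \<le> 2 * E S" "\<bar>virial_moment S T\<bar> \<le> 2 * E T" using S T by (auto intro!: virial_moment_bound)
    then show "virial_moment S S - virial_moment S T \<le> 4 * E T" using ES by linarith
  qed
  finally have "E0 * (\<Lambda> - ln 2) \<le> (24 * \<Lambda> + 3) * (E T - E0) + (12 * \<Lambda> + 7) * decay_const * T
    + 24 * (ln 2 * E T + K) + 4 * E T" .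
  then have "\<Lambda> * (E0 - B) \<le> M"
    unfolding M_def B_def by (simp add: algebra_simps)
  moreover have "N * (E0 - B) \<le> \<Lambda> * (E0 - B)" using \<Lambda> B by (intro mult_right_mono) auto
  ultimately show False using N by simp
qed

lemma E_tendsto_0: "(E \<longlongrightarrow> 0) (at_right 0)"
proof -
  define E0 where "E0 = Inf (E ` {0<..T0})"
  have bdd: "bdd_below (E ` {0<..T0})" using E_nonneg by (intro bdd_belowI[of _ 0]) auto
  have E0: "E0 \<le> E t" if "0 < t" "t \<le> T0" for t
    unfolding E0_def using bdd that by (intro cInf_lower) auto
  have E0_nonneg: "0 \<le> E0"
    unfolding E0_def using E_nonneg T0 by (intro cInf_greatest) auto
  have approx: "\<exists>t0. 0 < t0 \<and> t0 \<le> T0 \<and> E t0 < E0 + e" if "e > 0" for e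
    using cInf_lessD[of "E ` {0<..T0}" "E0 + e"] that T0 by (auto simp: E0_def)
  have "E0 = 0"
  proof (rule ccontr)
    assume "E0 \<noteq> 0"
    then have pos: "E0 > 0" using E0_nonneg by simp
    \<comment> \<open>With both errors at most E0 / 100, the bound reads E0 \<le> (24 + 12) E0 /
      100, which is absurd.\<close>
    obtain t0 where t0: "0 < t0" "t0 \<le> T0" "E t0 < E0 + E0 / 100" using approx[of "E0 / 100"] pos by auto
    define T where "T = min t0 (min 1 (E0 / 100) / (decay_const + 1))"
    have T: "0 < T" "T \<le> t0" "T \<le> min 1 (E0 / 100) / (decay_const + 1)"
      using t0 pos decay_const_nonneg by (auto simp: T_def)
    have "(decay_const + 1) * T \<le> min 1 (E0 / 100)" using T decay_const_nonneg by (simp add: le_divide_eq mult.commute)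
    then have CT: "decay_const * T \<le> 1" "decay_const * T \<le> E0 / 100" using T by (auto simp: algebra_simps)
    have "E0 \<le> 24 * (E T - E0) + 12 * decay_const * T"
      using T t0 CT E0_nonneg E0 by (intro energy_limit_bound) auto
    moreover have "E T \<le> E t0" using T t0 by (intro E_mono) auto
    ultimately show False using t0 CT pos by simp
  qed
  show ?thesis
  proof (rule tendstoI)
    fix e :: real assume "e > 0"
    then obtain t0 where t0: "0 < t0" "t0 \<le> T0" "E t0 < e" using approx \<open>E0 = 0\<close> by auto
    have "eventually (\<lambda>t. 0 < t \<and> t < t0) (at_right (0::real))"
      using t0 eventually_at_right_field by blast
    then show "eventually (\<lambda>t. dist (E t) 0 < e) (at_right 0)"
    proof eventually_elim
      case (elim t)
      then have "0 \<le> E t" "E t \<le> E t0" using t0 by (auto intro!: E_nonneg E_mono)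
      then show ?case using t0 by simp
    qed
  qed
qed

end

section \<open>Reduction of a smooth solution to the axiomatic setting\<close>

theorem theorem1:
  fixes \<alpha> T0 :: real and u :: "real \<Rightarrow> real \<Rightarrow> real"
  assumes "\<alpha> > 0" and "T0 > 0"
    and "smooth_on_set u (Omega T0)"
    and "\<And>t r. (t, r) \<in> Omega T0 \<Longrightarrow> r > 0 \<Longrightarrow> skyrme_eq \<alpha> u t r"
    and "\<And>t. 0 < t \<Longrightarrow> t \<le> T0 \<Longrightarrow> u t 0 = 0"
  shows "((\<lambda>T. integral {0..T} (\<lambda>r. energy_density \<alpha> u T r * r)) \<longlongrightarrow> 0) (at_right 0)"
proof -
  obtain U where U: "open U" "Omega T0 \<subseteq> U" and "\<And>k. Ck_on k (\<lambda>(t, r). u t r) U"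
    using assms(3) by (auto simp: smooth_on_set_def smooth_open_def)
  then have "Ck_on (Suc (Suc 0)) (\<lambda>(t, r). u t r) U" by blast
  then obtain g h gt gr ht hr where
    du: "\<And>x. x \<in> U \<Longrightarrow> ((\<lambda>(t, r). u t r) has_derivative (\<lambda>(a, b). a * g x + b * h x)) (at x)"
    and dg: "\<And>x. x \<in> U \<Longrightarrow> (g has_derivative (\<lambda>(a, b). a * gt x + b * gr x)) (at x)"
    and dh: "\<And>x. x \<in> U \<Longrightarrow> (h has_derivative (\<lambda>(a, b). a * ht x + b * hr x)) (at x)"
    and c2: "continuous_on U gt" "continuous_on U gr" "continuous_on U ht" "continuous_on U hr"
    unfolding Ck_on.simps by blast
  have dg': "((\<lambda>(t, r). g (t, r)) has_derivative (\<lambda>(a, b). a * gt x + b * gr x)) (at x)"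
    and dh': "((\<lambda>(t, r). h (t, r)) has_derivative (\<lambda>(a, b). a * ht x + b * hr x)) (at x)" if "x \<in> U" for x
    using dg[OF that] dh[OF that] by (simp_all add: case_prod_beta')
  have c1: "continuous_on U (\<lambda>(t, r). u t r)" "continuous_on U g" "continuous_on U h"
    by (rule has_derivative_continuous_on, rule has_derivative_at_withinI, erule du dg dh)+
  note along = has_real_derivative_along_curve
  have ut: "((\<lambda>s. u s r) has_real_derivative g (t, r)) (at t)"
    and ur: "(u t has_real_derivative h (t, r)) (at r)"
    and utt: "((\<lambda>s. g (s, r)) has_real_derivative gt (t, r)) (at t)"
    and utr: "((\<lambda>s. g (t, s)) has_real_derivative gr (t, r)) (at r)"
    and urt: "((\<lambda>s. h (s, r)) has_real_derivative ht (t, r)) (at t)"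
    and urr: "((\<lambda>s. h (t, s)) has_real_derivative hr (t, r)) (at r)"
    if "(t, r) \<in> U" for t r
    using along[where x = "\<lambda>s. s" and y = "\<lambda>_. r" and x' = 1 and y' = 0 and t = t, OF du[OF that]]
      along[where x = "\<lambda>_. t" and y = "\<lambda>s. s" and x' = 0 and y' = 1 and t = r, OF du[OF that]]
      along[where x = "\<lambda>s. s" and y = "\<lambda>_. r" and x' = 1 and y' = 0 and t = t, OF dg'[OF that]]
      along[where x = "\<lambda>_. t" and y = "\<lambda>s. s" and x' = 0 and y' = 1 and t = r, OF dg'[OF that]]
      along[where x = "\<lambda>s. s" and y = "\<lambda>_. r" and x' = 1 and y' = 0 and t = t, OF dh'[OF that]]
      along[where x = "\<lambda>_. t" and y = "\<lambda>s. s" and x' = 0 and y' = 1 and t = r, OF dh'[OF that]]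
    by simp_all
  \<comment> \<open>The locale works with a single mixed derivative \<open>utr\<close>.\<close>
  have mixed: "ht (t, r) = gr (t, r)" if "(t, r) \<in> U" for t r
    by (rule mixed_partials_eq[of U t r u "\<lambda>t r. g (t, r)" "\<lambda>t r. h (t, r)" "\<lambda>t r. gr (t, r)" "\<lambda>t r. ht (t, r)", symmetric])
      (use U that ut ur utr urt c2 in \<open>auto simp: case_prod_beta'\<close>)
  have dt1: "dt u t r = g (t, r)" and dr1: "dr u t r = h (t, r)" if "(t, r) \<in> U" for t r
    unfolding dt_def dr_def using ut[OF that] ur[OF that] by (auto intro!: DERIV_imp_deriv)
  have dt2: "dt (dt u) t r = gt (t, r)" if "(t, r) \<in> U" for t r
  proof -
    \<comment> \<open>As \<open>dt\<close> is a \<open>deriv\<close>, differentiating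
      \<open>dt u\<close> requires its formula at all nearby times; openness of \<open>U\<close>
      provides them.\<close>
    have "open ((\<lambda>s. (s, r)) -` U)" by (intro open_vimage U continuous_intros)
    then have "((\<lambda>s. dt u s r) has_real_derivative gt (t, r)) (at t)"
      by (rule has_field_derivative_transform_within_open[OF utt[OF that]]) (use that dt1 in auto)
    then show ?thesis unfolding dt_def[of "dt u"] by (rule DERIV_imp_deriv)
  qed
  have dr2: "dr (dr u) t r = hr (t, r)" if "(t, r) \<in> U" for t r
  proof -
    have "open (Pair t -` U)" by (intro open_vimage U continuous_intros)
    then have "((\<lambda>s. dr u t s) has_real_derivative hr (t, r)) (at r)"
      by (rule has_field_derivative_transform_within_open[OF urr[OF that]]) (use that dr1 in auto)
    then show ?thesis unfolding dr_def[of "dr u"] by (rule DERIV_imp_deriv)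
  qed
  \<comment> \<open>Hadamard's formula for sin u / r: the r-derivative of sin u averaged over the
    segment from the axis. It is continuous up to r = 0, and the segment stays in the cone.\<close>
  define k where "k t r = integral (cbox 0 1) (\<lambda>\<theta>. cos (u t (r * \<theta>)) * h (t, r * \<theta>))" for t r :: real
  have shrink: "(t, r * \<theta>) \<in> Omega T0" if "(t, r) \<in> Omega T0" "0 \<le> \<theta>" "\<theta> \<le> 1" for t r \<theta> :: real
    using that mult_left_le[of \<theta> r] by (auto simp: Omega_def)
  have rk: "r * k t r = sin (u t r)" if O: "(t, r) \<in> Omega T0" for t r
  proof -
    have "((\<lambda>\<theta>. r * (cos (u t (r * \<theta>)) * h (t, r * \<theta>))) has_integral sin (u t (r * 1)) - sin (u t (r * 0))) {0..1}"
    proof (rule fundamental_theorem_of_calculus)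
      fix \<theta> :: real assume "\<theta> \<in> {0..1}"
      then have "(t, r * \<theta>) \<in> Omega T0" using O shrink by auto
      then have "(u t has_real_derivative h (t, r * \<theta>)) (at (r * \<theta>))" using U by (intro ur) auto
      from DERIV_chain2[where g = "\<lambda>\<theta>. r * \<theta>", OF this DERIV_cmult_Id]
      have "((\<lambda>\<theta>. sin (u t (r * \<theta>))) has_real_derivative r * (cos (u t (r * \<theta>)) * h (t, r * \<theta>))) (at \<theta>)"
        by (auto intro!: derivative_eq_intros)
      then show "((\<lambda>\<theta>. sin (u t (r * \<theta>))) has_vector_derivative r * (cos (u t (r * \<theta>)) * h (t, r * \<theta>))) (at \<theta> within {0..1})"
        by (simp add: has_real_derivative_iff_has_vector_derivative has_vector_derivative_at_within)
    qed simp
    then have "integral {0..1} (\<lambda>\<theta>. r * (cos (u t (r * \<theta>)) * h (t, r * \<theta>))) = sin (u t r)"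
      using O assms(5)[of t] by (auto simp: Omega_def dest!: integral_unique)
    then show ?thesis by (simp add: k_def)
  qed
  have cO: "continuous_on (Omega T0) (\<lambda>x. u (fst x) (snd x))" "continuous_on (Omega T0) (\<lambda>x. f (fst x, snd x))"
    if "continuous_on U f" for f :: "real \<times> real \<Rightarrow> real"
    using c1(1) that U(2) by (auto simp: case_prod_beta' intro: continuous_on_subset)
  have ck: "continuous_on (Omega T0) (\<lambda>x. k (fst x) (snd x))"
    unfolding k_def
  proof (rule integral_continuous_on_param)
    let ?f = "\<lambda>x::(real \<times> real) \<times> real. (fst (fst x), snd (fst x) * snd x)"
    have 1: "continuous_on (Omega T0 \<times> cbox 0 1) ?f" by (intro continuous_intros)
    have 2: "?f ` (Omega T0 \<times> cbox 0 1) \<subseteq> U"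
    proof -
      have "?f ` (Omega T0 \<times> cbox 0 1) \<subseteq> Omega T0"
        using shrink by auto
      then show ?thesis using U by blast
    qed
    have 3: "continuous_on (Omega T0 \<times> cbox 0 1) (\<lambda>x. u (fst (fst x)) (snd (fst x) * snd x))"
      using continuous_on_compose2[OF c1(1) 1 2] by (simp add: case_prod_beta')
    have 4: "continuous_on (Omega T0 \<times> cbox 0 1) (\<lambda>x. h (fst (fst x), snd (fst x) * snd x))"
      using continuous_on_compose2[OF c1(3) 1 2] by simp
    show "continuous_on (Omega T0 \<times> cbox 0 1) (\<lambda>(x, \<theta>). cos (u (fst x) (snd x * \<theta>)) * h (fst x, snd x * \<theta>))"
      unfolding case_prod_beta' by (intro continuous_intros 3 4)
  qed
  have ut0: "g (t, 0) = 0" if t: "0 < t" "t \<le> T0" for t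
  proof -
    have "(t, 0) \<in> Omega T0" using t by (simp add: Omega_def)
    then have "(t, 0) \<in> U" using U by blast
    \<comment> \<open>The boundary condition holds only up to \<open>T0\<close>, so the derivative
      is computed within an interval that ends at \<open>t\<close>.\<close>
    from has_field_derivative_at_within[OF ut[OF this], of "{t / 2..t}"]
    have "((\<lambda>s. 0) has_real_derivative g (t, 0)) (at t within {t / 2..t})"
      by (rule has_field_derivative_transform_within[OF _ zero_less_one]) (use t assms(5) in auto)
    moreover have "((\<lambda>s. 0) has_real_derivative 0) (at t within {t / 2..t})" by simp
    ultimately show ?thesis
      unfolding has_real_derivative_iff_has_vector_derivative
      using vector_derivative_unique_within_closed_interval[of "t / 2" t t "\<lambda>s. 0" "g (t, 0)" 0] t by auto
  qed
  interpret skyrme_cone \<alpha> T0 u "\<lambda>t r. g (t, r)" "\<lambda>t r. h (t, r)" "\<lambda>t r. gt (t, r)" "\<lambda>t r. gr (t, r)" "\<lambda>t r. hr (t, r)" k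
  proof
    fix t r assume O: "(t, r) \<in> Omega T0"
    then have tU: "(t, r) \<in> U" using U by auto
    show "((\<lambda>(t, r). u t r) has_derivative (\<lambda>(a, b). a * g (t, r) + b * h (t, r))) (at (t, r))"
      "((\<lambda>(t, r). g (t, r)) has_derivative (\<lambda>(a, b). a * gt (t, r) + b * gr (t, r))) (at (t, r))"
      "((\<lambda>(t, r). h (t, r)) has_derivative (\<lambda>(a, b). a * gr (t, r) + b * hr (t, r))) (at (t, r))"
      using du[OF tU] dg'[OF tU] dh'[OF tU] mixed[OF tU] by simp_all
    assume r: "0 < r"
    have s: "sin (u t r) = r * k t r" using rk[OF O] by simp
    have "(1 + \<alpha>\<^sup>2 * (k t r)\<^sup>2) * (gt (t, r) - hr (t, r)) - (1 - \<alpha>\<^sup>2 * (k t r)\<^sup>2) * h (t, r) / r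
      + k t r * cos (u t r) / r * (\<alpha>\<^sup>2 * ((g (t, r))\<^sup>2 - (h (t, r))\<^sup>2) + 1) = 0"
      using assms(4)[OF O r] r unfolding skyrme_eq_def dt2[OF tU] dr2[OF tU] dt1[OF tU] dr1[OF tU] sin_double s
      by (simp add: power_mult_distrib power2_eq_square mult.assoc)
    moreover have "r * X * d - Y * e + Z * W = 0" if "X * d - Y * e / r + Z / r * W = 0" for X Y Z W d e :: real
      using that r by (simp add: field_simps)
    ultimately show "r * (1 + \<alpha>\<^sup>2 * (k t r)\<^sup>2) * (gt (t, r) - hr (t, r)) - (1 - \<alpha>\<^sup>2 * (k t r)\<^sup>2) * h (t, r)
      + k t r * cos (u t r) * (\<alpha>\<^sup>2 * ((g (t, r))\<^sup>2 - (h (t, r))\<^sup>2) + 1) = 0"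
      by blast
  qed (fact assms(1) | fact assms(2) | fact cO(1)[OF c1(2)] | fact cO(2)[OF c1(2)] | fact cO(2)[OF c1(3)]
      | fact cO(2)[OF c2(1)] | fact cO(2)[OF c2(2)] | fact cO(2)[OF c2(4)] | fact ck | fact rk | fact assms(5) | fact ut0)+
  have "energy_density \<alpha> u t r * r = edens t r" if O: "(t, r) \<in> Omega T0" for t r
  \<comment> \<open>On the axis the quotients in \<open>energy_density\<close> are 0 by convention
    and differ from \<open>k\<close>, but the factor r makes both sides vanish.\<close>
  proof (cases "r = 0")
    case False
    then have s: "sin (u t r) / r = k t r" using rk[OF O] by (simp add: field_simps)
    have "(t, r) \<in> U" using O U by auto
    moreover have "(sin (u t r))\<^sup>2 / r\<^sup>2 = (k t r)\<^sup>2" by (simp add: s[symmetric] power_divide)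
    ultimately show ?thesis
      unfolding energy_density_def edens_def dt1[OF \<open>(t, r) \<in> U\<close>] dr1[OF \<open>(t, r) \<in> U\<close>] s[symmetric]
      by (simp add: power_divide algebra_simps add_divide_distrib)
  qed (simp add: edens_def)
  then have "integral {0..T} (\<lambda>r. energy_density \<alpha> u T r * r) = E T" if "0 < T" "T < T0" for T
    unfolding E_def using that by (intro integral_cong) (auto simp: Omega_def)
  then have "eventually (\<lambda>T. E T = integral {0..T} (\<lambda>r. energy_density \<alpha> u T r * r)) (at_right 0)"
    using \<open>T0 > 0\<close> by (auto simp: eventually_at_right_field)
  with E_tendsto_0 show ?thesis by (rule Lim_transform_eventually)
qed

end
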